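(* Let $\Lambda_1=(V_1,E_1)$ and $\Lambda_2=(V_2,E_2)$ be hypergraphs. Then the game $*$-algebra $\mathcal A(\mathrm{HypIso}(\Lambda_1,\Lambda_2))$ is (canonically isomorphic to) the universal unital $*$-algebra generated by elements $\{p_{v_1,v_2}\}_{v_1\in V_1,v_2\in V_2}$ and $\{p_{e_1,e_2}\}_{e_1\in E_1,e_2\in E_2}$ such that: (i) $P_V:=(p_{v_1,v_2})_{v_1\in V_1,v_2\in V_2}$ and $P_E:=(p_{e_1,e_2})_{e_1\in E_1,e_2\in E_2}$ are magic unitaries; (ii) the incidence intertwining relation $A_{\Lambda_1}P_E=P_VA_{\Lambda_2}$ holds.
   Context: Algebras are over $\mathbb C$. A hypergraph $\Lambda=(V,E)$ consists of a finite set $V$ of vertices and a finite non-empty family $E$ of hyperedges, each $e\in E$ being identified with a subset of $V$; repeated hyperedges are allowed, and two hyperedges are equal only if they are the same element of $E$. All hypergraphs are assumed full: every vertex lies in some hyperedge. The incidence matrix $A_\Lambda$ is the $V\times E$ matrix with entry $1$ at $(v,e)$ if $v\in e$ and $0$ otherwise. A magic unitary over a unital $*$-algebra is a matrix $(p_{i,j})_{i\in I,j\in J}$ ($I,J$ finite) with $p_{i,j}=p_{i,j}^*=p_{i,j}^2$, $\sum_jp_{i,j}=1$ for all $i$, $\sum_ip_{i,j}=1$ for all $j$, $p_{i,j}p_{i,j'}=0$ for $j\ne j'$ and $p_{i,j}p_{i',j}=0$ for $i\neq i'$. The game $\mathrm{HypIso}(\Lambda_1,\Lambda_2)$ has all question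 and answer sets equal to $X:=V_1\sqcup V_2\sqcup E_1\sqcup E_2$ and rule function $\lambda:X^4\to\{0,1\}$, where $\lambda(x,y,a,b)=1$ ($x,y$ questions to Alice, Bob; $a,b$ their answers) iff: (i) if $x\in V_i$ then $a\in V_{3-i}$, if $x\in E_i$ then $a\in E_{3-i}$, and similarly for $(y,b)$; (ii) if $x\in V_i$ and $y\in E_i$, then $x\in y\iff a\in b$; (iii) if $x,y$ are both vertices, let $v_A,w_A$ be the elements of $\{x,a\}$ in $V_1,V_2$ and $v_B,w_B$ the elements of $\{y,b\}$ in $V_1,V_2$; then the relation between $v_A,v_B$ in $\Lambda_1$ (equal / adjacent, i.e. distinct and in a common hyperedge / distinct non-adjacent) is the same as that between $w_A,w_B$ in $\Lambda_2$; (iv) if $x,y$ are both hyperedges, with the analogous notation $e_A,e_B\in E_1$, $f_A,f_B\in E_2$, the relation between $e_A,e_B$ (equal / intersecting, i.e. distinct with non-empty intersection / disjoint) is the same as that between $f_A,f_B$. The game $*$-algebra $\mathcal A(\mathcal G)$ of a synchronous game with question set $X$, answer set $A$ and rule $\lambda$ is the universal unital $*$-algebra generated by $\{e_{x,a}:x\in X,a\in A\}$ subject to $e_{x,a}=e_{x,a}^*=e_{x,a}^2$; $\sum_{a}e_{x,a}=1$ for each $x$; and $e_{x,a}e_{y,b}=0$ whenever $\lambda(x,y,a,b)=0$. Under the canonical isomorphism, $p_{v_1,v_2}$ and $p_{e_1,e_2}$ correspond to the generators $e_{v_1,v_2}$, $e_{e_1,e_2}$. *)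

theory Defs
  imports Complex_Main "HOL-Algebra.QuotRing" "HOL-Algebra.Module" "HOL-Library.Poly_Mapping"
begin

section \<open>Unital star-algebras over the complex numbers\<close>

record 'a star_algebra = "(complex, 'a) module" +
  star :: "'a \<Rightarrow> 'a"

locale star_algebra = ring A for A :: "('a, 'm) star_algebra_scheme" (structure) +
  assumes smult_closed: "x \<in> carrier A \<Longrightarrow> c \<odot> x \<in> carrier A"
    and smult_l_distr: "x \<in> carrier A \<Longrightarrow> (c + d) \<odot> x = c \<odot> x \<oplus> d \<odot> x"
    and smult_r_distr: "\<lbrakk>x \<in> carrier A; y \<in> carrier A\<rbrakk> \<Longrightarrow> c \<odot> (x \<oplus> y) = c \<odot> x \<oplus> c \<odot> y"
    and smult_assoc: "x \<in> carrier A \<Longrightarrow> (c * d) \<odot> x = c \<odot> (d \<odot> x)"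
    and smult_one: "x \<in> carrier A \<Longrightarrow> 1 \<odot> x = x"
    and smult_mult_left: "\<lbrakk>x \<in> carrier A; y \<in> carrier A\<rbrakk> \<Longrightarrow> (c \<odot> x) \<otimes> y = c \<odot> (x \<otimes> y)"
    and smult_mult_right: "\<lbrakk>x \<in> carrier A; y \<in> carrier A\<rbrakk> \<Longrightarrow> x \<otimes> (c \<odot> y) = c \<odot> (x \<otimes> y)"
    and star_closed: "x \<in> carrier A \<Longrightarrow> star A x \<in> carrier A"
    and star_star: "x \<in> carrier A \<Longrightarrow> star A (star A x) = x"
    and star_add: "\<lbrakk>x \<in> carrier A; y \<in> carrier A\<rbrakk> \<Longrightarrow> star A (x \<oplus> y) = star A x \<oplus> star A y"
    and star_smult: "x \<in> carrier A \<Longrightarrow> star A (c \<odot> x) = cnj c \<odot> star A x"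
    and star_mult: "\<lbrakk>x \<in> carrier A; y \<in> carrier A\<rbrakk> \<Longrightarrow> star A (x \<otimes> y) = star A y \<otimes> star A x"

definition star_hom ::
  "('a, 'm) star_algebra_scheme \<Rightarrow> ('b, 'n) star_algebra_scheme \<Rightarrow> ('a \<Rightarrow> 'b) set"
  where "star_hom A B =
    {h \<in> ring_hom A B. \<forall>x\<in>carrier A. (\<forall>c. h (c \<odot>\<^bsub>A\<^esub> x) = c \<odot>\<^bsub>B\<^esub> h x) \<and> h (star A x) = star B (h x)}"

definition star_iso ::
  "('a, 'm) star_algebra_scheme \<Rightarrow> ('b, 'n) star_algebra_scheme \<Rightarrow> ('a \<Rightarrow> 'b) set"
  where "star_iso A B = {h \<in> star_hom A B. bij_betw h (carrier A) (carrier B)}"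

definition star_ideal :: "('a, 'm) star_algebra_scheme \<Rightarrow> 'a set \<Rightarrow> bool"
  where "star_ideal A I \<longleftrightarrow> ideal I A \<and> star A ` I \<subseteq> I"

definition star_ideal_generated :: "('a, 'm) star_algebra_scheme \<Rightarrow> 'a set \<Rightarrow> 'a set"
  where "star_ideal_generated A R = \<Inter>{I. star_ideal A I \<and> R \<subseteq> I}"

text \<open>The carrier consists of the cosets of \<open>I\<close>; ring operations are those of \<^const>\<open>FactRing\<close>.\<close>

definition star_quotient ::
  "('a, 'm) star_algebra_scheme \<Rightarrow> 'a set \<Rightarrow> 'a set star_algebra"
  where "star_quotient A I =
    \<lparr>carrier = carrier (A Quot I), mult = mult (A Quot I), one = one (A Quot I),
     zero = zero (A Quot I), add = add (A Quot I),
     smult = (\<lambda>c X. \<Union>x\<in>X. I +>\<^bsub>A\<^esub> (c \<odot>\<^bsub>A\<^esub> x)),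
     star = (\<lambda>X. \<Union>x\<in>X. I +>\<^bsub>A\<^esub> star A x)\<rparr>"


section \<open>Free star-algebras and presentations\<close>

text \<open>
  The free unital star-algebra on \<open>S\<close> is the monoid algebra over the complex numbers of the free
  monoid on the letters \<open>g\<close> and \<open>g*\<close> with \<open>g \<in> S\<close>. Words are written additively, since
  multiplication of finitely supported functions is convolution over a \<open>monoid_add\<close>.
\<close>

datatype 'g letter = Plain 'g | Starred 'g

datatype 'g word = Word (letters: "'g letter list")

instantiation word :: (type) monoid_add
begin

definition "0 = Word []"
definition "u + v = Word (letters u @ letters v)"

instance
  by standard (simp_all add: zero_word_def plus_word_def)

end

fun letter_star :: "'g letter \<Rightarrow> 'g letter" where
  "letter_star (Plain g) = Starred g"
| "letter_star (Starred g) = Plain g"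

definition word_star :: "'g word \<Rightarrow> 'g word"
  where "word_star w = Word (rev (map letter_star (letters w)))"

type_synonym 'g star_poly = "'g word \<Rightarrow>\<^sub>0 complex"

definition gen :: "'g \<Rightarrow> 'g star_poly"
  where "gen g = Poly_Mapping.single (Word [Plain g]) 1"

definition poly_smult :: "complex \<Rightarrow> 'g star_poly \<Rightarrow> 'g star_poly"
  where "poly_smult c p = Poly_Mapping.single 0 c * p"

definition poly_star :: "'g star_poly \<Rightarrow> 'g star_poly"
  where "poly_star p =
    (\<Sum>w\<in>Poly_Mapping.keys p. Poly_Mapping.single (word_star w) (cnj (Poly_Mapping.lookup p w)))"

definition free_star_algebra :: "'g set \<Rightarrow> 'g star_poly star_algebra"
  where "free_star_algebra S =
    \<lparr>carrier = {p. \<forall>w\<in>Poly_Mapping.keys p. \<forall>l\<in>set (letters w). set_letter l \<subseteq> S},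
     mult = (*), one = 1, zero = 0, add = (+), smult = poly_smult, star = poly_star\<rparr>"

text \<open>
  The universal unital star-algebra generated by \<open>S\<close> subject to the relations \<open>r = 0\<close> for \<open>r \<in> R\<close>,
  and the class in it of a generator. The algebra may be zero.
\<close>

definition universal_star_algebra :: "'g set \<Rightarrow> 'g star_poly set \<Rightarrow> 'g star_poly set star_algebra"
  where "universal_star_algebra S R =
    star_quotient (free_star_algebra S) (star_ideal_generated (free_star_algebra S) R)"

definition universal_gen :: "'g set \<Rightarrow> 'g star_poly set \<Rightarrow> 'g \<Rightarrow> 'g star_poly set"
  where "universal_gen S R g =
    star_ideal_generated (free_star_algebra S) R +>\<^bsub>free_star_algebra S\<^esub> gen g"


section \<open>Hypergraphs\<close>

text \<open>
  The hyperedges form an index set, so that distinct elements of \<open>edges\<close> may have the same set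
  \<open>ends\<close> of vertices. Empty hyperedges are allowed.
\<close>

record ('v, 'e) hypergraph =
  verts :: "'v set"
  edges :: "'e set"
  ends :: "'e \<Rightarrow> 'v set"

definition full_hypergraph :: "('v, 'e) hypergraph \<Rightarrow> bool"
  where "full_hypergraph \<Lambda> \<longleftrightarrow>
    finite (verts \<Lambda>) \<and> finite (edges \<Lambda>) \<and> edges \<Lambda> \<noteq> {} \<and>
    (\<forall>e\<in>edges \<Lambda>. ends \<Lambda> e \<subseteq> verts \<Lambda>) \<and>
    (\<forall>v\<in>verts \<Lambda>. \<exists>e\<in>edges \<Lambda>. v \<in> ends \<Lambda> e)"

definition incidence_matrix :: "('v, 'e) hypergraph \<Rightarrow> 'v \<Rightarrow> 'e \<Rightarrow> 'a::zero_neq_one"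
  where "incidence_matrix \<Lambda> v e = (if v \<in> ends \<Lambda> e then 1 else 0)"

datatype relation = Same | Related | Unrelated

definition vertex_relation :: "('v, 'e) hypergraph \<Rightarrow> 'v \<Rightarrow> 'v \<Rightarrow> relation"
  where "vertex_relation \<Lambda> v v' =
    (if v = v' then Same
     else if \<exists>e\<in>edges \<Lambda>. v \<in> ends \<Lambda> e \<and> v' \<in> ends \<Lambda> e then Related
     else Unrelated)"

definition edge_relation :: "('v, 'e) hypergraph \<Rightarrow> 'e \<Rightarrow> 'e \<Rightarrow> relation"
  where "edge_relation \<Lambda> e e' =
    (if e = e' then Same else if ends \<Lambda> e \<inter> ends \<Lambda> e' \<noteq> {} then Related else Unrelated)"


section \<open>The hypergraph isomorphism game\<close>

definition game_relations ::
  "'x set \<Rightarrow> 'a set \<Rightarrow> ('x \<Rightarrow> 'x \<Rightarrow> 'a \<Rightarrow> 'a \<Rightarrow> bool) \<Rightarrow> ('x \<times> 'a) star_poly set"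
  where "game_relations X A rule =
    {poly_star (gen (x, a)) - gen (x, a) | x a. x \<in> X \<and> a \<in> A} \<union>
    {gen (x, a) * gen (x, a) - gen (x, a) | x a. x \<in> X \<and> a \<in> A} \<union>
    {(\<Sum>a\<in>A. gen (x, a)) - 1 | x. x \<in> X} \<union>
    {gen (x, a) * gen (y, b) | x y a b. x \<in> X \<and> y \<in> X \<and> a \<in> A \<and> b \<in> A \<and> \<not> rule x y a b}"

definition game_algebra ::
  "'x set \<Rightarrow> 'a set \<Rightarrow> ('x \<Rightarrow> 'x \<Rightarrow> 'a \<Rightarrow> 'a \<Rightarrow> bool) \<Rightarrow> ('x \<times> 'a) star_poly set star_algebra"
  where "game_algebra X A rule = universal_star_algebra (X \<times> A) (game_relations X A rule)"

definition game_gen ::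
  "'x set \<Rightarrow> 'a set \<Rightarrow> ('x \<Rightarrow> 'x \<Rightarrow> 'a \<Rightarrow> 'a \<Rightarrow> bool) \<Rightarrow> 'x \<Rightarrow> 'a \<Rightarrow> ('x \<times> 'a) star_poly set"
  where "game_gen X A rule x a = universal_gen (X \<times> A) (game_relations X A rule) (x, a)"

datatype ('v1, 'v2, 'e1, 'e2) item = V1 'v1 | V2 'v2 | E1 'e1 | E2 'e2

definition hypiso_items ::
  "('v1, 'e1) hypergraph \<Rightarrow> ('v2, 'e2) hypergraph \<Rightarrow> ('v1, 'v2, 'e1, 'e2) item set"
  where "hypiso_items \<Lambda>1 \<Lambda>2 =
    V1 ` verts \<Lambda>1 \<union> V2 ` verts \<Lambda>2 \<union> E1 ` edges \<Lambda>1 \<union> E2 ` edges \<Lambda>2"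

fun answer_kind :: "('v1, 'v2, 'e1, 'e2) item \<Rightarrow> ('v1, 'v2, 'e1, 'e2) item \<Rightarrow> bool" where
  "answer_kind (V1 v) a \<longleftrightarrow> (\<exists>w. a = V2 w)"
| "answer_kind (V2 w) a \<longleftrightarrow> (\<exists>v. a = V1 v)"
| "answer_kind (E1 e) a \<longleftrightarrow> (\<exists>f. a = E2 f)"
| "answer_kind (E2 f) a \<longleftrightarrow> (\<exists>e. a = E1 e)"

definition hypiso_rule ::
  "('v1, 'e1) hypergraph \<Rightarrow> ('v2, 'e2) hypergraph \<Rightarrow>
    ('v1, 'v2, 'e1, 'e2) item \<Rightarrow> ('v1, 'v2, 'e1, 'e2) item \<Rightarrow>
    ('v1, 'v2, 'e1, 'e2) item \<Rightarrow> ('v1, 'v2, 'e1, 'e2) item \<Rightarrow> bool"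
  where "hypiso_rule \<Lambda>1 \<Lambda>2 x y a b \<longleftrightarrow>
    answer_kind x a \<and> answer_kind y b \<and>
    (\<forall>v w e f. x = V1 v \<and> a = V2 w \<and> y = E1 e \<and> b = E2 f \<longrightarrow>
      (v \<in> ends \<Lambda>1 e \<longleftrightarrow> w \<in> ends \<Lambda>2 f)) \<and>
    (\<forall>v w e f. x = V2 w \<and> a = V1 v \<and> y = E2 f \<and> b = E1 e \<longrightarrow>
      (w \<in> ends \<Lambda>2 f \<longleftrightarrow> v \<in> ends \<Lambda>1 e)) \<and>
    (\<forall>vA wA vB wB. {x, a} = {V1 vA, V2 wA} \<and> {y, b} = {V1 vB, V2 wB} \<longrightarrow>
      vertex_relation \<Lambda>1 vA vB = vertex_relation \<Lambda>2 wA wB) \<and>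
    (\<forall>eA fA eB fB. {x, a} = {E1 eA, E2 fA} \<and> {y, b} = {E1 eB, E2 fB} \<longrightarrow>
      edge_relation \<Lambda>1 eA eB = edge_relation \<Lambda>2 fA fB)"

definition hypiso_algebra ::
  "('v1, 'e1) hypergraph \<Rightarrow> ('v2, 'e2) hypergraph \<Rightarrow>
    (('v1, 'v2, 'e1, 'e2) item \<times> ('v1, 'v2, 'e1, 'e2) item) star_poly set star_algebra"
  where "hypiso_algebra \<Lambda>1 \<Lambda>2 =
    game_algebra (hypiso_items \<Lambda>1 \<Lambda>2) (hypiso_items \<Lambda>1 \<Lambda>2) (hypiso_rule \<Lambda>1 \<Lambda>2)"

definition hypiso_gen ::
  "('v1, 'e1) hypergraph \<Rightarrow> ('v2, 'e2) hypergraph \<Rightarrow>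
    ('v1, 'v2, 'e1, 'e2) item \<Rightarrow> ('v1, 'v2, 'e1, 'e2) item \<Rightarrow>
    (('v1, 'v2, 'e1, 'e2) item \<times> ('v1, 'v2, 'e1, 'e2) item) star_poly set"
  where "hypiso_gen \<Lambda>1 \<Lambda>2 =
    game_gen (hypiso_items \<Lambda>1 \<Lambda>2) (hypiso_items \<Lambda>1 \<Lambda>2) (hypiso_rule \<Lambda>1 \<Lambda>2)"


section \<open>Magic unitaries intertwining the incidence matrices\<close>

text \<open>The relations stating that \<open>(p i j)\<close>, with \<open>i \<in> I\<close> and \<open>j \<in> J\<close>, is a magic unitary.\<close>

definition magic_unitary_relations ::
  "'i set \<Rightarrow> 'j set \<Rightarrow> ('i \<Rightarrow> 'j \<Rightarrow> 'g star_poly) \<Rightarrow> 'g star_poly set"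
  where "magic_unitary_relations I J p =
    {poly_star (p i j) - p i j | i j. i \<in> I \<and> j \<in> J} \<union>
    {p i j * p i j - p i j | i j. i \<in> I \<and> j \<in> J} \<union>
    {(\<Sum>j\<in>J. p i j) - 1 | i. i \<in> I} \<union>
    {(\<Sum>i\<in>I. p i j) - 1 | j. j \<in> J} \<union>
    {p i j * p i j' | i j j'. i \<in> I \<and> j \<in> J \<and> j' \<in> J \<and> j \<noteq> j'} \<union>
    {p i j * p i' j | i i' j. i \<in> I \<and> i' \<in> I \<and> j \<in> J \<and> i \<noteq> i'}"

definition matrix_product ::
  "'j set \<Rightarrow> ('i \<Rightarrow> 'j \<Rightarrow> 'a) \<Rightarrow> ('j \<Rightarrow> 'k \<Rightarrow> 'a) \<Rightarrow> 'i \<Rightarrow> 'k \<Rightarrow> 'a::semiring_0"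
  where "matrix_product J M N i k = (\<Sum>j\<in>J. M i j * N j k)"

text \<open>The generators \<open>p\<^bsub>v,w\<^esub>\<close> and \<open>p\<^bsub>e,f\<^esub>\<close> are indexed by \<open>Inl (v, w)\<close> and \<open>Inr (e, f)\<close>.\<close>

definition intertwiner_indices ::
  "('v1, 'e1) hypergraph \<Rightarrow> ('v2, 'e2) hypergraph \<Rightarrow> ('v1 \<times> 'v2 + 'e1 \<times> 'e2) set"
  where "intertwiner_indices \<Lambda>1 \<Lambda>2 =
    Inl ` (verts \<Lambda>1 \<times> verts \<Lambda>2) \<union> Inr ` (edges \<Lambda>1 \<times> edges \<Lambda>2)"

definition intertwiner_relations ::
  "('v1, 'e1) hypergraph \<Rightarrow> ('v2, 'e2) hypergraph \<Rightarrow> ('v1 \<times> 'v2 + 'e1 \<times> 'e2) star_poly set"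
  where "intertwiner_relations \<Lambda>1 \<Lambda>2 =
    (let PV = \<lambda>v w. gen (Inl (v, w)); PE = \<lambda>e f. gen (Inr (e, f)) in
      magic_unitary_relations (verts \<Lambda>1) (verts \<Lambda>2) PV \<union>
      magic_unitary_relations (edges \<Lambda>1) (edges \<Lambda>2) PE \<union>
      {matrix_product (edges \<Lambda>1) (incidence_matrix \<Lambda>1) PE v f -
       matrix_product (verts \<Lambda>2) PV (incidence_matrix \<Lambda>2) v f
       | v f. v \<in> verts \<Lambda>1 \<and> f \<in> edges \<Lambda>2})"

definition intertwiner_algebra ::
  "('v1, 'e1) hypergraph \<Rightarrow> ('v2, 'e2) hypergraph \<Rightarrow>
    ('v1 \<times> 'v2 + 'e1 \<times> 'e2) star_poly set star_algebra"
  where "intertwiner_algebra \<Lambda>1 \<Lambda>2 =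
    universal_star_algebra (intertwiner_indices \<Lambda>1 \<Lambda>2) (intertwiner_relations \<Lambda>1 \<Lambda>2)"

definition vertex_gen ::
  "('v1, 'e1) hypergraph \<Rightarrow> ('v2, 'e2) hypergraph \<Rightarrow> 'v1 \<Rightarrow> 'v2 \<Rightarrow>
    ('v1 \<times> 'v2 + 'e1 \<times> 'e2) star_poly set"
  where "vertex_gen \<Lambda>1 \<Lambda>2 v w =
    universal_gen (intertwiner_indices \<Lambda>1 \<Lambda>2) (intertwiner_relations \<Lambda>1 \<Lambda>2) (Inl (v, w))"

definition edge_gen ::
  "('v1, 'e1) hypergraph \<Rightarrow> ('v2, 'e2) hypergraph \<Rightarrow> 'e1 \<Rightarrow> 'e2 \<Rightarrow>
    ('v1 \<times> 'v2 + 'e1 \<times> 'e2) star_poly set"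
  where "edge_gen \<Lambda>1 \<Lambda>2 e f =
    universal_gen (intertwiner_indices \<Lambda>1 \<Lambda>2) (intertwiner_relations \<Lambda>1 \<Lambda>2) (Inr (e, f))"


section \<open>Presented star-algebras have the universal property\<close>

lemma letter_star_simps [simp]:
  "letter_star (letter_star l) = l" "set_letter (letter_star l) = set_letter l"
  by (cases l; simp)+

lemma word_star_simps [simp]:
  "word_star (word_star w) = w" "word_star 0 = 0" "word_star (u + v) = word_star v + word_star u"
  by (cases w; simp add: word_star_def rev_map o_def zero_word_def plus_word_def)+

lemma lookup_poly_star [simp]:
  "Poly_Mapping.lookup (poly_star p) w = cnj (Poly_Mapping.lookup p (word_star w))"
proof -
  have "Poly_Mapping.lookup (poly_star p) w =
     (\<Sum>u\<in>Poly_Mapping.keys p. if u = word_star w then cnj (Poly_Mapping.lookup p u) else 0)"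
    unfolding poly_star_def lookup_sum
    by (intro sum.cong refl) (auto simp: lookup_single when_def)
  also have "\<dots> = cnj (Poly_Mapping.lookup p (word_star w))"
    by (simp add: sum.delta in_keys_iff)
  finally show ?thesis .
qed

lemma poly_star_simps [simp]:
  "poly_star (p + q) = poly_star p + poly_star q" "poly_star 0 = 0"
  "poly_star (poly_star p) = p"
  by (auto intro!: poly_mapping_eqI simp: lookup_add)

lemma poly_star_single [simp]:
  "poly_star (Poly_Mapping.single w c) = Poly_Mapping.single (word_star w) (cnj c)"
  by (rule poly_mapping_eqI) (auto simp: lookup_single when_def)

lemma single_induct [case_names zero single add]:
  fixes p :: "'b \<Rightarrow>\<^sub>0 complex"
  assumes "P 0" "\<And>w c. P (Poly_Mapping.single w c)" "\<And>p q. P p \<Longrightarrow> P q \<Longrightarrow> P (p + q)"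
  shows "P p"
proof (induction p rule: update_induct)
  case const then show ?case using assms(1) .
next
  case (update p a b)
  have "Poly_Mapping.update a b p = Poly_Mapping.single a b + p"
    using update by (intro poly_mapping_eqI) (auto simp: lookup_add lookup_update lookup_single when_def in_keys_iff)
  then show ?case using assms update by simp
qed

lemma poly_star_mult [simp]: "poly_star (p * q) = poly_star q * poly_star p"
proof (induction p rule: single_induct)
  case (single w c)
  show ?case
    by (induction q rule: single_induct) (simp_all add: mult_single algebra_simps)
qed (simp_all add: algebra_simps)

lemma poly_smult_mult:
  "poly_smult c p * q = poly_smult c (p * q)" "p * poly_smult c q = poly_smult c (p * q)"
proof -
  have comm: "p * Poly_Mapping.single 0 c = Poly_Mapping.single 0 c * p" for p :: "'b star_poly"
    by (induction p rule: single_induct) (simp_all add: mult_single algebra_simps)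
  show "poly_smult c p * q = poly_smult c (p * q)" "p * poly_smult c q = poly_smult c (p * q)"
    unfolding poly_smult_def by (simp_all add: mult.assoc comm flip: comm)
qed

definition word_in :: "'g set \<Rightarrow> 'g word \<Rightarrow> bool" where
  "word_in S w \<longleftrightarrow> (\<forall>l\<in>set (letters w). set_letter l \<subseteq> S)"

lemma word_in_simps [simp]: "word_in S 0" "word_in S (u + v) \<longleftrightarrow> word_in S u \<and> word_in S v"
  by (auto simp: word_in_def zero_word_def plus_word_def)

lemma word_in_star [simp]: "word_in S (word_star w) = word_in S w"
  by (simp add: word_in_def word_star_def)

lemma carrier_free: "carrier (free_star_algebra S) = {p. \<forall>w\<in>Poly_Mapping.keys p. word_in S w}"
  by (simp add: free_star_algebra_def word_in_def)

lemma carrier_free_intros: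
  "p \<in> carrier (free_star_algebra S) \<Longrightarrow> q \<in> carrier (free_star_algebra S) \<Longrightarrow> p + q \<in> carrier (free_star_algebra S)"
  "p \<in> carrier (free_star_algebra S) \<Longrightarrow> q \<in> carrier (free_star_algebra S) \<Longrightarrow> p - q \<in> carrier (free_star_algebra S)"
  "p \<in> carrier (free_star_algebra S) \<Longrightarrow> q \<in> carrier (free_star_algebra S) \<Longrightarrow> p * q \<in> carrier (free_star_algebra S)"
  "p \<in> carrier (free_star_algebra S) \<Longrightarrow> poly_star p \<in> carrier (free_star_algebra S)"
  "p \<in> carrier (free_star_algebra S) \<Longrightarrow> - p \<in> carrier (free_star_algebra S)"
  "1 \<in> carrier (free_star_algebra S)" "0 \<in> carrier (free_star_algebra S)"
  "word_in S w \<Longrightarrow> Poly_Mapping.single w c \<in> carrier (free_star_algebra S)"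
  "p \<in> carrier (free_star_algebra S) \<Longrightarrow> poly_smult c p \<in> carrier (free_star_algebra S)"
proof -
  show add: "p \<in> carrier (free_star_algebra S) \<Longrightarrow> q \<in> carrier (free_star_algebra S) \<Longrightarrow> p + q \<in> carrier (free_star_algebra S)" for p q
    using keys_add[of p q] by (auto simp: carrier_free)
  show m: "p \<in> carrier (free_star_algebra S) \<Longrightarrow> - p \<in> carrier (free_star_algebra S)" for p
    by (auto simp: carrier_free in_keys_iff)
  show "p \<in> carrier (free_star_algebra S) \<Longrightarrow> q \<in> carrier (free_star_algebra S) \<Longrightarrow> p - q \<in> carrier (free_star_algebra S)"
    using add[of p "-q"] m[of q] by simp
  show mu: "p \<in> carrier (free_star_algebra S) \<Longrightarrow> q \<in> carrier (free_star_algebra S) \<Longrightarrow> p * q \<in> carrier (free_star_algebra S)" for p q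
    using keys_mult[of p q] by (fastforce simp: carrier_free)
  show "p \<in> carrier (free_star_algebra S) \<Longrightarrow> poly_star p \<in> carrier (free_star_algebra S)"
    unfolding carrier_free mem_Collect_eq in_keys_iff lookup_poly_star Ball_def
    by (metis complex_cnj_zero word_in_star)
  show s: "word_in S w \<Longrightarrow> Poly_Mapping.single w c \<in> carrier (free_star_algebra S)" for w c
    by (auto simp: carrier_free)
  show "p \<in> carrier (free_star_algebra S) \<Longrightarrow> poly_smult c p \<in> carrier (free_star_algebra S)"
    unfolding poly_smult_def by (intro mu s) auto
  show "1 \<in> carrier (free_star_algebra S)" "0 \<in> carrier (free_star_algebra S)"
    by (auto simp: carrier_free)
qed

lemma free_simps [simp]:
  "(\<otimes>\<^bsub>free_star_algebra S\<^esub>) = (*)" "(\<oplus>\<^bsub>free_star_algebra S\<^esub>) = (+)"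
  "\<one>\<^bsub>free_star_algebra S\<^esub> = 1" "\<zero>\<^bsub>free_star_algebra S\<^esub> = 0"
  "(\<odot>\<^bsub>free_star_algebra S\<^esub>) = poly_smult" "star (free_star_algebra S) = poly_star"
  by (simp_all add: free_star_algebra_def)

lemma free_star_algebra: "star_algebra (free_star_algebra S)"
proof -
  have "ring (free_star_algebra S)"
  proof (rule ringI)
    show "abelian_group (free_star_algebra S)"
    proof (rule abelian_groupI)
      show "\<exists>y\<in>carrier (free_star_algebra S). y \<oplus>\<^bsub>free_star_algebra S\<^esub> x = \<zero>\<^bsub>free_star_algebra S\<^esub>"
        if "x \<in> carrier (free_star_algebra S)" for x
        using carrier_free_intros(5)[OF that] by (intro bexI[of _ "-x"]) auto
    qed (auto intro: carrier_free_intros simp: algebra_simps)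
    show "Group.monoid (free_star_algebra S)"
      by (rule Group.monoidI) (auto intro: carrier_free_intros simp: algebra_simps)
  qed (auto simp: algebra_simps)
  then show ?thesis
    by (intro star_algebra.intro star_algebra_axioms.intro)
       (auto intro: carrier_free_intros simp: poly_smult_mult,
        auto simp: poly_smult_def algebra_simps single_add mult_single
          simp flip: mult.assoc,
        metis poly_smult_def poly_smult_mult(2) mult.right_neutral mult.left_neutral)
qed


context star_algebra
begin

lemma smult_zero_right: "c \<odot> \<zero> = \<zero>"
  using smult_r_distr[of \<zero> \<zero> c] smult_closed[of \<zero> c] by (simp add: add.r_cancel_one')

lemma smult_zero_left: "x \<in> carrier A \<Longrightarrow> 0 \<odot> x = \<zero>"
  using smult_l_distr[of x 0 0] smult_closed[of x 0] by (simp add: add.r_cancel_one')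

lemma star_zero: "star A \<zero> = \<zero>"
  using star_add[of \<zero> \<zero>] star_closed[of \<zero>] by (simp add: add.r_cancel_one')

lemma star_one: "star A \<one> = \<one>"
  using star_mult[of "star A \<one>" \<one>] star_star[of \<one>] star_closed[of \<one>] by simp

lemma star_ideal_smult:
  assumes "star_ideal A I" "x \<in> I" shows "c \<odot> x \<in> I"
proof -
  interpret ideal I A using assms by (simp add: star_ideal_def)
  have "(c \<odot> \<one>) \<otimes> x = c \<odot> x" using assms a_Hcarr by (simp add: smult_mult_left)
  moreover have "(c \<odot> \<one>) \<otimes> x \<in> I" using assms by (intro I_l_closed smult_closed) auto
  ultimately show ?thesis by simp
qed

lemma coset_map:
  assumes "ideal I A" "x \<in> carrier A"
    and f: "\<And>y. y \<in> carrier A \<Longrightarrow> f y \<in> carrier A" "\<And>y. y \<in> I \<Longrightarrow> f y \<in> I"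
      "\<And>y z. y \<in> carrier A \<Longrightarrow> z \<in> carrier A \<Longrightarrow> f (y \<oplus> z) = f y \<oplus> f z"
  shows "(\<Union>y\<in>I +> x. I +> f y) = I +> f x"
proof -
  interpret ideal I A by fact
  have "I +> f y = I +> f x" if "y \<in> I +> x" for y
  proof -
    from that obtain i where i: "i \<in> I" "y = i \<oplus> x" by (auto simp: a_r_coset_def r_coset_def)
    then have "f y = f i \<oplus> f x" "f i \<in> I" using f assms a_Hcarr by auto
    then have "f y \<in> I +> f x" by (auto simp: a_r_coset_def r_coset_def)
    then show ?thesis using a_repr_independence f assms by (metis is_additive_subgroup additive_subgroup.a_subgroup)
  qed
  moreover have "x \<in> I +> x" using a_rcos_self assms by blast
  ultimately show ?thesis by blast
qed

lemma star_quotient_simps: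
  assumes "star_ideal A I" "x \<in> carrier A" "y \<in> carrier A"
  shows "smult (star_quotient A I) c (I +> x) = I +> c \<odot> x"
    "star (star_quotient A I) (I +> x) = I +> star A x"
    "(I +> x) \<otimes>\<^bsub>star_quotient A I\<^esub> (I +> y) = I +> x \<otimes> y"
    "(I +> x) \<oplus>\<^bsub>star_quotient A I\<^esub> (I +> y) = I +> x \<oplus> y"
    "\<one>\<^bsub>star_quotient A I\<^esub> = I +> \<one>"
    "\<zero>\<^bsub>star_quotient A I\<^esub> = I"
    "carrier (star_quotient A I) = (+>) I ` carrier A"
proof -
  interpret ideal I A using assms by (simp add: star_ideal_def)
  show "smult (star_quotient A I) c (I +> x) = I +> c \<odot> x"
    unfolding star_quotient_def using assms
    by simp (intro coset_map is_ideal smult_closed star_ideal_smult smult_r_distr; assumption)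
  show "star (star_quotient A I) (I +> x) = I +> star A x"
    unfolding star_quotient_def using assms
    by simp (intro coset_map is_ideal star_closed star_add; auto simp: star_ideal_def)
  show "(I +> x) \<otimes>\<^bsub>star_quotient A I\<^esub> (I +> y) = I +> x \<otimes> y"
    "(I +> x) \<oplus>\<^bsub>star_quotient A I\<^esub> (I +> y) = I +> x \<oplus> y"
    "\<one>\<^bsub>star_quotient A I\<^esub> = I +> \<one>"
    "\<zero>\<^bsub>star_quotient A I\<^esub> = I"
    "carrier (star_quotient A I) = (+>) I ` carrier A"
    using assms by (auto simp: star_quotient_def FactRing_simps rcoset_mult_add a_rcos_sum)
qed

lemma star_algebra_quotient:
  assumes I: "star_ideal A I"
  shows "star_algebra (star_quotient A I)"
proof -
  interpret ideal I A using assms by (simp add: star_ideal_def)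
  interpret Q: ring "A Quot I" by (rule quotient_is_ring)
  have flds: "carrier (star_quotient A I) = carrier (A Quot I)"
    "(\<otimes>\<^bsub>star_quotient A I\<^esub>) = (\<otimes>\<^bsub>A Quot I\<^esub>)" "(\<oplus>\<^bsub>star_quotient A I\<^esub>) = (\<oplus>\<^bsub>A Quot I\<^esub>)"
    "\<zero>\<^bsub>star_quotient A I\<^esub> = \<zero>\<^bsub>A Quot I\<^esub>" "\<one>\<^bsub>star_quotient A I\<^esub> = \<one>\<^bsub>A Quot I\<^esub>"
    by (simp_all add: star_quotient_def)
  have "ring (star_quotient A I)"
  proof (rule ringI)
    show "abelian_group (star_quotient A I)"
      by (rule abelian_groupI) (auto simp: flds Q.add.m_ac intro: Q.add.l_inv_ex)
    show "Group.monoid (star_quotient A I)"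
      by (rule Group.monoidI) (auto simp: flds Q.m_assoc)
  qed (auto simp: flds Q.l_distr Q.r_distr)
  moreover have "carrier (star_quotient A I) = (+>) I ` carrier A"
    using star_quotient_simps(7)[of I \<one> \<one>] I by simp
  ultimately show ?thesis
    by (intro star_algebra.intro star_algebra_axioms.intro)
      (auto simp: star_quotient_simps[OF I] smult_closed smult_l_distr smult_r_distr smult_assoc
        smult_one smult_mult_left smult_mult_right star_closed star_star star_add star_smult star_mult)
qed

lemma star_ideal_generated:
  assumes "R \<subseteq> carrier A"
  shows "star_ideal A (star_ideal_generated A R)" "R \<subseteq> star_ideal_generated A R"
proof -
  have "star_ideal A (carrier A)"
    using oneideal star_closed by (auto simp: star_ideal_def)
  then have "ideal (star_ideal_generated A R) A"
    unfolding star_ideal_generated_def using assms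
    by (intro i_Intersect) (auto simp: star_ideal_def)
  then show "star_ideal A (star_ideal_generated A R)"
    by (auto simp: star_ideal_def star_ideal_generated_def)
  show "R \<subseteq> star_ideal_generated A R" by (auto simp: star_ideal_generated_def)
qed

definition word_eval where
  "word_eval h w = foldr (\<lambda>l x. (case l of Plain g \<Rightarrow> h g | Starred g \<Rightarrow> star A (h g)) \<otimes> x) (letters w) \<one>"

definition eval where
  "eval h p = (\<Oplus>w\<in>Poly_Mapping.keys p. Poly_Mapping.lookup p w \<odot> word_eval h w)"

context
  fixes h :: "'g \<Rightarrow> 'a"
  assumes h: "\<And>g. h g \<in> carrier A"
begin

lemma word_eval_closed [simp]: "word_eval h w \<in> carrier A"
proof (cases w)
  case (Word ls)
  show ?thesis unfolding Word word_eval_def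
    by (induction ls) (auto split: letter.splits simp: h star_closed)
qed

lemma word_eval_plus: "word_eval h (u + v) = word_eval h u \<otimes> word_eval h v"
proof (cases u; cases v)
  fix us vs assume uv: "u = Word us" "v = Word vs"
  have "word_eval h (Word vs) \<in> carrier A" "\<And>us. word_eval h (Word us) \<in> carrier A" by auto
  then show ?thesis unfolding uv plus_word_def word_eval_def
    by (induction us) (auto split: letter.splits simp: h star_closed m_assoc)
qed

lemma word_eval_zero [simp]: "word_eval h 0 = \<one>"
  by (simp add: word_eval_def zero_word_def)

lemma word_eval_Cons:
  "word_eval h (Word (l # ls)) = (case l of Plain g \<Rightarrow> h g | Starred g \<Rightarrow> star A (h g)) \<otimes> word_eval h (Word ls)"
  by (simp add: word_eval_def)

lemma word_eval_star: "word_eval h (word_star w) = star A (word_eval h w)"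
proof (cases w)
  case (Word ls)
  show ?thesis unfolding Word
  proof (induction ls)
    case Nil
    then show ?case using word_eval_zero word_star_simps(2) by (metis star_one zero_word_def)
  next
    case (Cons l ls)
    have "word_star (Word (l # ls)) = word_star (Word ls) + Word [letter_star l]"
      by (simp add: word_star_def plus_word_def)
    moreover have "word_eval h (Word [letter_star l]) = star A (case l of Plain g \<Rightarrow> h g | Starred g \<Rightarrow> star A (h g))"
      by (cases l) (simp_all add: word_eval_def h star_star star_closed)
    ultimately show ?case
      using Cons by (cases l) (simp_all add: word_eval_plus word_eval_Cons star_mult h star_closed)
  qed
qed

lemma eval_superset:
  assumes "finite K" "Poly_Mapping.keys p \<subseteq> K"
  shows "eval h p = (\<Oplus>w\<in>K. Poly_Mapping.lookup p w \<odot> word_eval h w)"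
  unfolding eval_def using assms
  by (intro add.finprod_mono_neutral_cong_left)
     (auto simp: in_keys_iff smult_zero_left smult_closed)

lemma eval_closed [simp]: "eval h p \<in> carrier A"
  unfolding eval_def by (intro finsum_closed) (auto simp: smult_closed)

lemma eval_add: "eval h (p + q) = eval h p \<oplus> eval h q"
proof -
  let ?K = "Poly_Mapping.keys p \<union> Poly_Mapping.keys q"
  have "eval h (p + q) = (\<Oplus>w\<in>?K. Poly_Mapping.lookup (p + q) w \<odot> word_eval h w)"
    using keys_add[of p q] by (intro eval_superset) auto
  also have "\<dots> = (\<Oplus>w\<in>?K. Poly_Mapping.lookup p w \<odot> word_eval h w \<oplus> Poly_Mapping.lookup q w \<odot> word_eval h w)"
    by (intro finsum_cong') (auto simp: lookup_add smult_l_distr smult_closed)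
  also have "\<dots> = eval h p \<oplus> eval h q"
    using eval_superset[of ?K p] eval_superset[of ?K q]
    by (subst finsum_addf) (auto simp: smult_closed)
  finally show ?thesis .
qed

lemma eval_single: "eval h (Poly_Mapping.single w c) = c \<odot> word_eval h w"
  using eval_superset[of "{w}" "Poly_Mapping.single w c"]
  by (auto simp: smult_closed)

lemma eval_zero [simp]: "eval h 0 = \<zero>"
  by (simp add: eval_def)

lemma eval_mult: "eval h (p * q) = eval h p \<otimes> eval h q"
proof (induction p rule: single_induct)
  case (single w c)
  show ?case
  proof (induction q rule: single_induct)
    case (single v d)
    show ?case
      by (simp add: mult_single eval_single word_eval_plus smult_mult_left smult_mult_right
          smult_closed mult.commute flip: smult_assoc)
  qed (auto simp: distrib_left eval_add r_distr)
qed (auto simp: distrib_right eval_add l_distr)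

lemma eval_smult: "eval h (poly_smult c p) = c \<odot> eval h p"
  unfolding poly_smult_def by (simp add: eval_mult eval_single smult_mult_left)

lemma eval_star: "eval h (poly_star p) = star A (eval h p)"
  by (induction p rule: single_induct)
    (auto simp: eval_add eval_single word_eval_star star_add star_smult star_zero)

lemma eval_one: "eval h 1 = \<one>"
  using eval_single[of 0 1] by (simp add: smult_one)

lemma eval_gen: "eval h (gen g) = h g"
  by (simp add: gen_def eval_single smult_one word_eval_def h)

lemma star_ideal_kernel: "star_ideal (free_star_algebra S) {p \<in> carrier (free_star_algebra S). eval h p = \<zero>}"
proof -
  interpret F: star_algebra "free_star_algebra S :: 'g star_poly star_algebra" by (rule free_star_algebra)
  have "ring_hom_ring (free_star_algebra S) A (eval h)"
    by (intro ring_hom_ringI F.ring_axioms ring_axioms) (auto simp: eval_add eval_mult eval_one)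
  then have "ideal (a_kernel (free_star_algebra S) A (eval h)) (free_star_algebra S)"
    by (rule ring_hom_ring.kernel_is_ideal)
  then show ?thesis
    by (auto simp: star_ideal_def a_kernel_def' eval_star star_zero intro: carrier_free_intros)
qed

end

end

lemma star_algebra_universal:
  assumes R: "R \<subseteq> carrier (free_star_algebra S)"
  shows "star_algebra (universal_star_algebra S R)"
  unfolding universal_star_algebra_def
  using star_algebra.star_algebra_quotient star_algebra.star_ideal_generated(1) free_star_algebra assms
  by blast

lemma eval_factors:
  fixes B :: "('b, 'm) star_algebra_scheme"
  assumes R: "R \<subseteq> carrier (free_star_algebra S)" and B: "star_algebra B"
    and h: "\<And>g. h g \<in> carrier B"
    and rel: "\<And>r. r \<in> R \<Longrightarrow> star_algebra.eval B h r = \<zero>\<^bsub>B\<^esub>"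
  shows "\<exists>\<psi>\<in>star_hom (universal_star_algebra S R) B.
     \<forall>p\<in>carrier (free_star_algebra S).
       \<psi> (star_ideal_generated (free_star_algebra S) R +>\<^bsub>free_star_algebra S\<^esub> p) = star_algebra.eval B h p"
proof -
  interpret B: star_algebra B by fact
  let ?F = "free_star_algebra S"
  interpret F: star_algebra ?F by (rule free_star_algebra)
  define I where "I = star_ideal_generated ?F R"
  have I: "star_ideal ?F I" unfolding I_def by (rule F.star_ideal_generated(1)[OF R])
  interpret I: ideal I ?F using I by (simp add: star_ideal_def)
  have ker: "I \<subseteq> {p \<in> carrier ?F. B.eval h p = \<zero>\<^bsub>B\<^esub>}"
    unfolding I_def star_ideal_generated_def using B.star_ideal_kernel[of h S] h rel R by auto
  define \<psi> where "\<psi> X = B.eval h (SOME p. p \<in> X)" for X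
  have psi: "\<psi> (I +>\<^bsub>?F\<^esub> p) = B.eval h p" if "p \<in> carrier ?F" for p
  proof -
    have "p \<in> I +>\<^bsub>?F\<^esub> p" using that by (rule I.a_rcos_self)
    then have "(SOME q. q \<in> I +>\<^bsub>?F\<^esub> p) \<in> I +>\<^bsub>?F\<^esub> p" by (rule someI)
    then obtain i where "i \<in> I" "(SOME q. q \<in> I +>\<^bsub>?F\<^esub> p) = i + p"
      by (auto simp: a_r_coset_def r_coset_def)
    then show ?thesis using ker h by (auto simp: \<psi>_def B.eval_add)
  qed
  have "\<psi> \<in> star_hom (universal_star_algebra S R) B"
    unfolding universal_star_algebra_def I_def[symmetric] star_hom_def ring_hom_def
    using F.star_quotient_simps(7)[OF I F.zero_closed F.zero_closed]
      F.star_quotient_simps(5)[OF I F.zero_closed F.zero_closed]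
    by (auto simp: F.star_quotient_simps[OF I] psi h B.eval_add B.eval_mult B.eval_one B.eval_smult
        B.eval_star carrier_free_intros)
  then show ?thesis using psi unfolding I_def by blast
qed


lemma star_hom_eq_eval:
  fixes B :: "('b, 'm) star_algebra_scheme"
  assumes R: "R \<subseteq> carrier (free_star_algebra S)" and B: "star_algebra B"
    and h: "\<And>g. h g \<in> carrier B"
    and \<psi>: "\<psi> \<in> star_hom (universal_star_algebra S R) B"
    and gens: "\<And>g. g \<in> S \<Longrightarrow> \<psi> (universal_gen S R g) = h g"
    and p: "p \<in> carrier (free_star_algebra S)"
  shows "\<psi> (star_ideal_generated (free_star_algebra S) R +>\<^bsub>free_star_algebra S\<^esub> p) = star_algebra.eval B h p"
proof -
  interpret B: star_algebra B by fact
  let ?F = "free_star_algebra S"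
  interpret F: star_algebra ?F by (rule free_star_algebra)
  define I where "I = star_ideal_generated ?F R"
  have I: "star_ideal ?F I" unfolding I_def by (rule F.star_ideal_generated(1)[OF R])
  define f where "f p = \<psi> (I +>\<^bsub>?F\<^esub> p)" for p
  note q = F.star_quotient_simps[OF I]
  have f: "f (p * q) = f p \<otimes>\<^bsub>B\<^esub> f q" "f (p + q) = f p \<oplus>\<^bsub>B\<^esub> f q" "f 1 = \<one>\<^bsub>B\<^esub>"
    "f (poly_smult c p) = c \<odot>\<^bsub>B\<^esub> f p" "f (poly_star p) = star B (f p)" "f p \<in> carrier B"
    if that: "p \<in> carrier ?F" "q \<in> carrier ?F" for p q c
  proof -
    let ?Q = "star_quotient ?F I"
    have hom: "\<psi> \<in> ring_hom ?Q B"
      "\<And>x c. x \<in> carrier ?Q \<Longrightarrow> \<psi> (c \<odot>\<^bsub>?Q\<^esub> x) = c \<odot>\<^bsub>B\<^esub> \<psi> x"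
      "\<And>x. x \<in> carrier ?Q \<Longrightarrow> \<psi> (star ?Q x) = star B (\<psi> x)"
      using \<psi> unfolding universal_star_algebra_def I_def[symmetric] star_hom_def by auto
    have c: "I +>\<^bsub>?F\<^esub> p \<in> carrier ?Q" "I +>\<^bsub>?F\<^esub> q \<in> carrier ?Q"
      unfolding q(7)[OF that] using that by auto
    show "f (p * q) = f p \<otimes>\<^bsub>B\<^esub> f q"
      using ring_hom_mult[OF hom(1) c] unfolding q(3)[OF that] f_def by simp
    show "f (p + q) = f p \<oplus>\<^bsub>B\<^esub> f q"
      using ring_hom_add[OF hom(1) c] unfolding q(4)[OF that] f_def by simp
    show "f 1 = \<one>\<^bsub>B\<^esub>"
      using ring_hom_one[OF hom(1)] unfolding q(5)[OF that] f_def by simp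
    show "f (poly_smult c p) = c \<odot>\<^bsub>B\<^esub> f p"
      using hom(2)[OF c(1)] unfolding q(1)[OF that] f_def by simp
    show "f (poly_star p) = star B (f p)"
      using hom(3)[OF c(1)] unfolding q(2)[OF that] f_def by simp
    show "f p \<in> carrier B"
      using ring_hom_closed[OF hom(1) c(1)] unfolding f_def .
  qed
  have zero: "f 0 = \<zero>\<^bsub>B\<^esub>"
    using f(4)[of 0 0 0] f(6)[of 0 0] carrier_free_intros(7)[of S]
    by (simp add: poly_smult_def B.smult_zero_left)
  have word: "f (Poly_Mapping.single w 1) = B.word_eval h w" if "word_in S w" for w
  proof (cases w)
    case (Word ls)
    show ?thesis using that unfolding Word
    proof (induction ls)
      case Nil
      then show ?case using f(3)[OF carrier_free_intros(6,6)] B.word_eval_zero[of h] h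
        by (simp flip: zero_word_def)
    next
      case (Cons l ls)
      obtain g where g: "g \<in> S" "l = Plain g \<or> l = Starred g"
        using Cons.prems by (cases l) (auto simp: word_in_def)
      have w: "word_in S (Word [l])" "word_in S (Word ls)" "word_in S (Word [Plain g])"
        using Cons.prems g by (auto simp: word_in_def)
      have "Poly_Mapping.single (Word (l # ls)) (1::complex)
          = Poly_Mapping.single (Word [l]) 1 * Poly_Mapping.single (Word ls) 1"
        by (simp add: mult_single plus_word_def)
      moreover have "f (gen g) = h g" using gens[OF g(1)] by (simp add: f_def I_def universal_gen_def)
      moreover have "f (poly_star (gen g)) = star B (f (gen g))"
        using f(5)[of "gen g" 0] carrier_free_intros(7,8) w(3) by (metis gen_def)
      ultimately show ?case
        using g(2) Cons.IH w f(1)[of "Poly_Mapping.single (Word [l]) 1" "Poly_Mapping.single (Word ls) 1"]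
        by (auto simp: carrier_free_intros gen_def word_star_def B.word_eval_Cons h)
    qed
  qed
  have "f p = B.eval h p" using p
  proof (induction p rule: update_induct)
    case const
    then show ?case using zero h by simp
  next
    case (update p a b)
    have eq: "Poly_Mapping.update a b p = poly_smult b (Poly_Mapping.single a 1) + p"
      using update(1) by (intro poly_mapping_eqI)
        (auto simp: poly_smult_def mult_single lookup_add lookup_update lookup_single when_def in_keys_iff)
    have "word_in S a" and p: "p \<in> carrier ?F"
      using update by (auto simp: carrier_free keys_update)
    then have a: "Poly_Mapping.single a 1 \<in> carrier ?F" by (simp add: carrier_free_intros)
    show ?case
      unfolding eq using update(3) p a word \<open>word_in S a\<close> h
      by (simp add: f B.eval_add B.eval_smult B.eval_single B.smult_one carrier_free_intros)
  qed
  then show ?thesis by (simp add: f_def I_def)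
qed

text \<open>
  The universal property. Only the values of \<open>h\<close> on \<open>S\<close> matter; \<open>eval B h r\<close> is the value of the
  star-polynomial \<open>r\<close> at \<open>h\<close>.
\<close>

lemma universal_property:
  fixes B :: "('b, 'm) star_algebra_scheme"
  assumes R: "R \<subseteq> carrier (free_star_algebra S)" and B: "star_algebra B"
    and h: "\<And>g. h g \<in> carrier B"
    and rel: "\<And>r. r \<in> R \<Longrightarrow> star_algebra.eval B h r = \<zero>\<^bsub>B\<^esub>"
  shows "\<exists>\<psi>\<in>star_hom (universal_star_algebra S R) B. \<forall>g\<in>S. \<psi> (universal_gen S R g) = h g"
    and "\<lbrakk>\<psi> \<in> star_hom (universal_star_algebra S R) B; \<chi> \<in> star_hom (universal_star_algebra S R) B;
      \<And>g. g \<in> S \<Longrightarrow> \<psi> (universal_gen S R g) = h g;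
      \<And>g. g \<in> S \<Longrightarrow> \<chi> (universal_gen S R g) = h g;
      x \<in> carrier (universal_star_algebra S R)\<rbrakk> \<Longrightarrow> \<psi> x = \<chi> x"
proof -
  interpret B: star_algebra B by fact
  have "gen g \<in> carrier (free_star_algebra S)" if "g \<in> S" for g
    using that by (simp add: gen_def carrier_free word_in_def)
  then show "\<exists>\<psi>\<in>star_hom (universal_star_algebra S R) B. \<forall>g\<in>S. \<psi> (universal_gen S R g) = h g"
    using eval_factors[OF R B h rel] B.eval_gen[of h] h unfolding universal_gen_def by metis
  interpret F: star_algebra "free_star_algebra S" by (rule free_star_algebra)
  have carr: "carrier (universal_star_algebra S R) =
      (+>\<^bsub>free_star_algebra S\<^esub>) (star_ideal_generated (free_star_algebra S) R) ` carrier (free_star_algebra S)"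
    unfolding universal_star_algebra_def
    by (rule F.star_quotient_simps(7)[OF F.star_ideal_generated(1)[OF R] F.zero_closed F.zero_closed])
  show "\<psi> x = \<chi> x"
    if "\<psi> \<in> star_hom (universal_star_algebra S R) B" "\<chi> \<in> star_hom (universal_star_algebra S R) B"
      "\<And>g. g \<in> S \<Longrightarrow> \<psi> (universal_gen S R g) = h g" "\<And>g. g \<in> S \<Longrightarrow> \<chi> (universal_gen S R g) = h g"
      "x \<in> carrier (universal_star_algebra S R)"
    using that(5) star_hom_eq_eval[OF R B h that(1,3)] star_hom_eq_eval[OF R B h that(2,4)]
    unfolding carr by auto
qed

end

theory Submission
  imports Defs
begin

text \<open>
  The intertwining relation is a statement about sums. The idea is to replace it by a statement
  about single products: for magic unitaries \<open>P\<close> and \<open>Q\<close> indexed by the vertices and the hyperedges,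
  it holds iff \<open>P v w \<otimes> Q e f = \<zero>\<close> whenever exactly one of \<open>v \<in> e\<close> and \<open>w \<in> f\<close> holds
  (\<open>intertwining_iff_compatible\<close>). This is the rule of the game for a vertex and a hyperedge. The
  proof multiplies the intertwining relation by \<open>P v w\<close> on the left and, in one direction, by \<open>Q e f\<close> on the right;
  orthogonality of rows and columns leaves a single term.

  Compatible magic unitaries already obey the rules for two vertices and for two hyperedges. If \<open>v\<close>
  and \<open>v'\<close> lie in a common hyperedge \<open>e\<close> but \<open>w\<close> and \<open>w'\<close> do not, then inserting \<open>\<one> = (\<Oplus>f. Q e f)\<close> between \<open>P v w\<close> and
  \<open>P v' w'\<close> kills every term, because a nonzero term would need a hyperedge \<open>f\<close> containing \<open>w\<close>
  and \<open>w'\<close>. The other cases follow by exchanging the two hypergraphs, or vertices and hyperedges,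
  and from the orthogonality of rows and columns. So \<open>P\<close> and \<open>Q\<close> define a representation of the game
  relations: a question from either hypergraph and an answer of the same kind from the other form a
  pair that indexes an entry of \<open>P\<close> or \<open>Q\<close>, and every other answer gets the projection zero.

  Conversely, in the game algebra an answer of the wrong kind loses against everything, itself
  included, so its projection, being idempotent, is zero. The remaining projections satisfy
  \<open>e (V2 w) (V1 v) = e (V1 v) (V2 w)\<close>, and likewise for hyperedges
  (\<open>opposite_partitions_eq\<close>). Hence the questions from the second hypergraph contribute no new
  generators; the equations that they satisfy say that the columns of \<open>P\<close> and \<open>Q\<close> sum to one.

  These two constructions exchange the generators of the two algebras, so by the universal
  properties the induced homomorphisms are mutually inverse (\<open>universal_star_algebra_iso\<close>).
\<close>

section \<open>Partitions of unity in a ring\<close>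

context ring
begin

lemma finsum_single_term:
  assumes "finite K" "k0 \<in> K" "f \<in> K \<rightarrow> carrier R" "\<And>k. \<lbrakk>k \<in> K; k \<noteq> k0\<rbrakk> \<Longrightarrow> f k = \<zero>"
  shows "(\<Oplus>k\<in>K. f k) = f k0"
proof -
  have "(\<Oplus>k\<in>K. f k) = (\<Oplus>k\<in>K. if k0 = k then f k else \<zero>)"
    using assms by (intro add.finprod_cong') auto
  then show ?thesis
    using add.finprod_singleton[of k0 K f] assms by simp
qed

lemma finsum_over_image:
  assumes "finite X" "inj_on c K" "c ` K \<subseteq> X" "f \<in> X \<rightarrow> carrier R"
    and "\<And>a. \<lbrakk>a \<in> X; a \<notin> c ` K\<rbrakk> \<Longrightarrow> f a = \<zero>"
  shows "(\<Oplus>a\<in>X. f a) = (\<Oplus>k\<in>K. f (c k))"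
proof -
  have "(\<Oplus>a\<in>c ` K. f a) = (\<Oplus>a\<in>X. f a)"
    using assms by (intro add.finprod_mono_neutral_cong_left) auto
  moreover have "(\<Oplus>a\<in>c ` K. f a) = (\<Oplus>k\<in>K. f (c k))"
    using assms by (intro add.finprod_reindex) auto
  ultimately show ?thesis by simp
qed

context
  fixes K :: "'k set" and f :: "'k \<Rightarrow> 'a"
  assumes K: "finite K" and f: "f \<in> K \<rightarrow> carrier R" and one: "(\<Oplus>k\<in>K. f k) = \<one>"
begin

lemma partition_expand_left:
  assumes "a \<in> carrier R"
  shows "(\<Oplus>k\<in>K. f k \<otimes> a) = a"
  using finsum_ldistr[OF K assms f] one assms by simp

lemma partition_expand_right:
  assumes "a \<in> carrier R"
  shows "(\<Oplus>k\<in>K. a \<otimes> f k) = a"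
  using finsum_rdistr[OF K assms f] one assms by simp

lemma partition_separates:
  assumes "a \<in> carrier R" "b \<in> carrier R" "\<And>k. k \<in> K \<Longrightarrow> f k \<otimes> a = f k \<otimes> b"
  shows "a = b"
proof -
  have "(\<Oplus>k\<in>K. f k \<otimes> a) = (\<Oplus>k\<in>K. f k \<otimes> b)"
    using assms f by (intro add.finprod_cong') auto
  then show ?thesis using assms by (simp add: partition_expand_left)
qed

text \<open>
  Inserting \<open>\<one> = (\<Oplus>k\<in>K. f k)\<close> between \<open>a\<close> and \<open>b\<close> writes the product as a sum of vanishing
  terms.
\<close>

lemma partition_between_zero:
  assumes a: "a \<in> carrier R" and b: "b \<in> carrier R"
    and zero: "\<And>k. k \<in> K \<Longrightarrow> a \<otimes> f k = \<zero> \<or> f k \<otimes> b = \<zero>"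
  shows "a \<otimes> b = \<zero>"
proof -
  have "a \<otimes> (f k \<otimes> b) = \<zero>" if "k \<in> K" for k
    using zero[OF that] a b f that m_assoc[of a "f k" b] by (auto simp: Pi_iff)
  then have "(\<Oplus>k\<in>K. a \<otimes> (f k \<otimes> b)) = \<zero>"
    by (simp add: add.finprod_one_eqI)
  moreover have "(\<Oplus>k\<in>K. a \<otimes> (f k \<otimes> b)) = a \<otimes> (\<Oplus>k\<in>K. f k \<otimes> b)"
    using K a b f by (intro finsum_rdistr[symmetric]) auto
  ultimately show ?thesis using b by (simp add: partition_expand_left)
qed

lemma partition_select_right:
  assumes "a \<in> carrier R" "k0 \<in> K" "\<And>k. \<lbrakk>k \<in> K; k \<noteq> k0\<rbrakk> \<Longrightarrow> a \<otimes> f k = \<zero>"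
  shows "a \<otimes> f k0 = a"
proof -
  have "(\<Oplus>k\<in>K. a \<otimes> f k) = a \<otimes> f k0"
    using assms K f by (intro finsum_single_term) auto
  then show ?thesis using assms by (simp add: partition_expand_right)
qed

lemma partition_select_left:
  assumes "a \<in> carrier R" "k0 \<in> K" "\<And>k. \<lbrakk>k \<in> K; k \<noteq> k0\<rbrakk> \<Longrightarrow> f k \<otimes> a = \<zero>"
  shows "f k0 \<otimes> a = a"
proof -
  have "(\<Oplus>k\<in>K. f k \<otimes> a) = f k0 \<otimes> a"
    using assms K f by (intro finsum_single_term) auto
  then show ?thesis using assms by (simp add: partition_expand_left)
qed

end

text \<open>
  Expanding \<open>p i j\<close> along the row \<open>q j\<close>, and \<open>q j i\<close> along the row \<open>p i\<close>, gives the same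
  product \<open>p i j \<otimes> q j i\<close>. This is how the answers to questions from one hypergraph determine
  the answers to questions from the other.
\<close>

lemma opposite_partitions_eq:
  assumes "finite I" "finite J" "i \<in> I" "j \<in> J"
    and p: "\<And>j. j \<in> J \<Longrightarrow> p i j \<in> carrier R" and q: "\<And>i. i \<in> I \<Longrightarrow> q j i \<in> carrier R"
    and "(\<Oplus>j\<in>J. p i j) = \<one>" "(\<Oplus>i\<in>I. q j i) = \<one>"
    and "\<And>i'. \<lbrakk>i' \<in> I; i' \<noteq> i\<rbrakk> \<Longrightarrow> p i j \<otimes> q j i' = \<zero>"
    and "\<And>j'. \<lbrakk>j' \<in> J; j' \<noteq> j\<rbrakk> \<Longrightarrow> p i j' \<otimes> q j i = \<zero>"
  shows "q j i = p i j"
proof -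
  have "p i j \<otimes> q j i = p i j"
    by (rule partition_select_right[where K = I and f = "q j"]) (use assms in auto)
  moreover have "p i j \<otimes> q j i = q j i"
    by (rule partition_select_left[where K = J and f = "p i"]) (use assms in auto)
  ultimately show ?thesis by simp
qed

end


section \<open>Magic unitaries compatible with incidence\<close>

locale magic_unitary = star_algebra A for A :: "('a, 'm) star_algebra_scheme" (structure) +
  fixes I :: "'i set" and J :: "'j set" and p :: "'i \<Rightarrow> 'j \<Rightarrow> 'a"
  assumes finite_rows: "finite I" and finite_cols: "finite J"
    and closed: "\<lbrakk>i \<in> I; j \<in> J\<rbrakk> \<Longrightarrow> p i j \<in> carrier A"
    and self_adjoint: "\<lbrakk>i \<in> I; j \<in> J\<rbrakk> \<Longrightarrow> star A (p i j) = p i j"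
    and idempotent: "\<lbrakk>i \<in> I; j \<in> J\<rbrakk> \<Longrightarrow> p i j \<otimes> p i j = p i j"
    and row_sum: "i \<in> I \<Longrightarrow> (\<Oplus>j\<in>J. p i j) = \<one>"
    and col_sum: "j \<in> J \<Longrightarrow> (\<Oplus>i\<in>I. p i j) = \<one>"
    and row_orthogonal: "\<lbrakk>i \<in> I; j \<in> J; j' \<in> J; j \<noteq> j'\<rbrakk> \<Longrightarrow> p i j \<otimes> p i j' = \<zero>"
    and col_orthogonal: "\<lbrakk>i \<in> I; i' \<in> I; j \<in> J; i \<noteq> i'\<rbrakk> \<Longrightarrow> p i j \<otimes> p i' j = \<zero>"
begin

lemma transpose: "magic_unitary A J I (\<lambda>j i. p i j)"
  by unfold_locales
    (auto intro: finite_rows finite_cols closed self_adjoint idempotent row_sum col_sum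
      row_orthogonal col_orthogonal)

end

locale compatible_unitaries =
  V: magic_unitary A "verts \<Lambda>1" "verts \<Lambda>2" P + E: magic_unitary A "edges \<Lambda>1" "edges \<Lambda>2" Q
  for A :: "('a, 'm) star_algebra_scheme" (structure)
    and \<Lambda>1 :: "('v1, 'e1) hypergraph" and \<Lambda>2 :: "('v2, 'e2) hypergraph" and P Q +
  assumes full1: "full_hypergraph \<Lambda>1" and full2: "full_hypergraph \<Lambda>2"
    and compatible: "\<lbrakk>v \<in> verts \<Lambda>1; w \<in> verts \<Lambda>2; e \<in> edges \<Lambda>1; f \<in> edges \<Lambda>2;
      (v \<in> ends \<Lambda>1 e) \<noteq> (w \<in> ends \<Lambda>2 f)\<rbrakk> \<Longrightarrow> P v w \<otimes> Q e f = \<zero>"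
begin

text \<open>Apply the involution: all entries are self-adjoint.\<close>

lemma compatible_commuted:
  assumes "v \<in> verts \<Lambda>1" "w \<in> verts \<Lambda>2" "e \<in> edges \<Lambda>1" "f \<in> edges \<Lambda>2"
    "(v \<in> ends \<Lambda>1 e) \<noteq> (w \<in> ends \<Lambda>2 f)"
  shows "Q e f \<otimes> P v w = \<zero>"
  using V.star_mult[of "P v w" "Q e f"] compatible[OF assms] assms
  by (simp add: V.closed E.closed V.self_adjoint E.self_adjoint V.star_zero)

lemma transpose: "compatible_unitaries A \<Lambda>2 \<Lambda>1 (\<lambda>w v. P v w) (\<lambda>f e. Q e f)"
  using V.transpose E.transpose full1 full2 compatible
  by (auto intro!: compatible_unitaries.intro compatible_unitaries_axioms.intro)

text \<open>
  The row of \<open>Q\<close> at a common hyperedge \<open>e\<close> is a partition of unity, and \<open>P v w \<otimes> Q e f \<otimes> P v' w'\<close>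
  can only be nonzero if \<open>f\<close> contains both \<open>w\<close> and \<open>w'\<close>.
\<close>

lemma common_edge_zero:
  assumes "v \<in> verts \<Lambda>1" "v' \<in> verts \<Lambda>1" "w \<in> verts \<Lambda>2" "w' \<in> verts \<Lambda>2"
    and e: "e \<in> edges \<Lambda>1" "v \<in> ends \<Lambda>1 e" "v' \<in> ends \<Lambda>1 e"
    and no: "\<not> (\<exists>f\<in>edges \<Lambda>2. w \<in> ends \<Lambda>2 f \<and> w' \<in> ends \<Lambda>2 f)"
  shows "P v w \<otimes> P v' w' = \<zero>"
  using assms by (intro V.partition_between_zero[where K = "edges \<Lambda>2" and f = "Q e"])
    (auto simp: E.finite_cols E.closed V.closed E.row_sum intro: compatible compatible_commuted)

text \<open>The dual argument, with the row of \<open>P\<close> at a common vertex as the partition of unity.\<close>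

lemma common_vertex_zero:
  assumes "e \<in> edges \<Lambda>1" "e' \<in> edges \<Lambda>1" "f \<in> edges \<Lambda>2" "f' \<in> edges \<Lambda>2"
    and v: "v \<in> ends \<Lambda>1 e" "v \<in> ends \<Lambda>1 e'"
    and no: "ends \<Lambda>2 f \<inter> ends \<Lambda>2 f' = {}"
  shows "Q e f \<otimes> Q e' f' = \<zero>"
proof -
  have "v \<in> verts \<Lambda>1" using full1 assms by (auto simp: full_hypergraph_def)
  then show ?thesis
    using assms by (intro V.partition_between_zero[where K = "verts \<Lambda>2" and f = "P v"])
      (auto simp: V.finite_cols E.closed V.closed V.row_sum intro: compatible compatible_commuted)
qed

text \<open>
  If exactly one of the two relations is \<^const>\<open>Same\<close>, two entries of one row or one column are
  multiplied. Otherwise exactly one of the pairs is adjacent, and by transposition it may be either.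
\<close>

lemma vertex_relation_zero:
  assumes "v \<in> verts \<Lambda>1" "v' \<in> verts \<Lambda>1" "w \<in> verts \<Lambda>2" "w' \<in> verts \<Lambda>2"
    and "vertex_relation \<Lambda>1 v v' \<noteq> vertex_relation \<Lambda>2 w w'"
  shows "P v w \<otimes> P v' w' = \<zero>"
  using assms V.row_orthogonal[of v w w'] V.col_orthogonal[of v v' w] common_edge_zero[of v v' w w']
    compatible_unitaries.common_edge_zero[OF transpose, of w w' v v']
  by (auto simp: vertex_relation_def split: if_splits)

lemma edge_relation_zero:
  assumes "e \<in> edges \<Lambda>1" "e' \<in> edges \<Lambda>1" "f \<in> edges \<Lambda>2" "f' \<in> edges \<Lambda>2"
    and "edge_relation \<Lambda>1 e e' \<noteq> edge_relation \<Lambda>2 f f'"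
  shows "Q e f \<otimes> Q e' f' = \<zero>"
  using assms E.row_orthogonal[of e f f'] E.col_orthogonal[of e e' f] common_vertex_zero[of e e' f f']
    compatible_unitaries.common_vertex_zero[OF transpose, of f f' e e']
  by (auto simp: edge_relation_def split: if_splits)

end

text \<open>
  Both sides of the intertwining relation, called \<open>S\<close> and \<open>T\<close> in the proof, are sums of entries of one
  column of \<open>Q\<close> and of one row of \<open>P\<close>. Multiplication by an entry of the same column, respectively
  row, therefore tests whether that entry occurs in the sum. For the converse, \<open>S = T\<close> may be
  checked after multiplication by each \<open>P v w\<close>, as these sum to one over \<open>w\<close>.
\<close>

lemma intertwining_iff_compatible:
  fixes A :: "('a, 'm) star_algebra_scheme" (structure)
  assumes "magic_unitary A X1 X2 P" and "magic_unitary A Y1 Y2 Q"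
  shows "(\<forall>v\<in>X1. \<forall>f\<in>Y2. (\<Oplus>e\<in>Y1. if v \<in> r1 e then Q e f else \<zero>) = (\<Oplus>w\<in>X2. if w \<in> r2 f then P v w else \<zero>))
    \<longleftrightarrow> (\<forall>v\<in>X1. \<forall>w\<in>X2. \<forall>e\<in>Y1. \<forall>f\<in>Y2. (v \<in> r1 e) \<noteq> (w \<in> r2 f) \<longrightarrow> P v w \<otimes> Q e f = \<zero>)"
    (is "?L \<longleftrightarrow> ?R")
proof -
  interpret V: magic_unitary A X1 X2 P by fact
  interpret E: magic_unitary A Y1 Y2 Q by fact
  define S where "S v f = (\<Oplus>e\<in>Y1. if v \<in> r1 e then Q e f else \<zero>)" for v f
  define T where "T v f = (\<Oplus>w\<in>X2. if w \<in> r2 f then P v w else \<zero>)" for v f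
  have S_closed: "S v f \<in> carrier A" if "f \<in> Y2" for v f
    unfolding S_def using that by (intro V.finsum_closed) (auto simp: E.closed)
  have T_closed: "T v f \<in> carrier A" if "v \<in> X1" for v f
    unfolding T_def using that by (intro V.finsum_closed) (auto simp: V.closed)
  have PT: "P v w \<otimes> T v f = (if w \<in> r2 f then P v w else \<zero>)" if "v \<in> X1" "w \<in> X2" "f \<in> Y2" for v w f
  proof -
    have "P v w \<otimes> T v f = (\<Oplus>w'\<in>X2. P v w \<otimes> (if w' \<in> r2 f then P v w' else \<zero>))"
      unfolding T_def using that V.finite_cols by (intro V.finsum_rdistr) (auto simp: V.closed)
    also have "\<dots> = P v w \<otimes> (if w \<in> r2 f then P v w else \<zero>)"
      using that V.finite_cols by (intro V.finsum_single_term) (auto simp: V.closed V.row_orthogonal)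
    finally show ?thesis using that by (auto simp: V.closed V.idempotent)
  qed
  have SQ: "S v f \<otimes> Q e f = (if v \<in> r1 e then Q e f else \<zero>)" if "v \<in> X1" "e \<in> Y1" "f \<in> Y2" for v e f
  proof -
    have "S v f \<otimes> Q e f = (\<Oplus>e'\<in>Y1. (if v \<in> r1 e' then Q e' f else \<zero>) \<otimes> Q e f)"
      unfolding S_def using that E.finite_rows by (intro V.finsum_ldistr) (auto simp: E.closed)
    also have "\<dots> = (if v \<in> r1 e then Q e f else \<zero>) \<otimes> Q e f"
      using that E.finite_rows by (intro V.finsum_single_term) (auto simp: E.closed E.col_orthogonal)
    finally show ?thesis using that by (auto simp: E.closed E.idempotent)
  qed
  have "?L \<longleftrightarrow> (\<forall>v\<in>X1. \<forall>f\<in>Y2. S v f = T v f)" by (simp add: S_def T_def)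
  also have "\<dots> \<longleftrightarrow> ?R"
  proof
    assume L: "\<forall>v\<in>X1. \<forall>f\<in>Y2. S v f = T v f"
    show ?R
    proof (intro ballI impI)
      fix v w e f assume i: "v \<in> X1" "w \<in> X2" "e \<in> Y1" "f \<in> Y2" and ne: "(v \<in> r1 e) \<noteq> (w \<in> r2 f)"
      \<comment> \<open>The left factor sees \<open>w \<in> r2 f\<close> and the right factor sees \<open>v \<in> r1 e\<close>.\<close>
      have "(P v w \<otimes> T v f) \<otimes> Q e f = P v w \<otimes> (S v f \<otimes> Q e f)"
        using i L by (simp add: V.m_assoc V.closed E.closed T_closed)
      then show "P v w \<otimes> Q e f = \<zero>"
        using ne i by (auto simp: PT SQ V.closed E.closed split: if_splits)
    qed
  next
    assume R: ?R
    show "\<forall>v\<in>X1. \<forall>f\<in>Y2. S v f = T v f"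
    proof (intro ballI)
      fix v f assume i: "v \<in> X1" "f \<in> Y2"
      have "P v w \<otimes> S v f = P v w \<otimes> T v f" if w: "w \<in> X2" for w
      proof -
        have "P v w \<otimes> S v f = (\<Oplus>e\<in>Y1. P v w \<otimes> (if v \<in> r1 e then Q e f else \<zero>))"
          unfolding S_def using i w E.finite_rows by (intro V.finsum_rdistr) (auto simp: E.closed V.closed)
        also have "\<dots> = (\<Oplus>e\<in>Y1. if w \<in> r2 f then P v w \<otimes> Q e f else \<zero>)"
          using R i w by (intro V.add.finprod_cong') (auto simp: E.closed V.closed)
        also have "\<dots> = (if w \<in> r2 f then P v w else \<zero>)"
          using V.partition_expand_right[of Y1 "\<lambda>e. Q e f" "P v w"] i w E.finite_rows
          by (auto simp: E.closed V.closed E.col_sum)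
        finally show ?thesis using PT i w by simp
      qed
      from V.partition_separates[OF V.finite_cols _ V.row_sum[OF i(1)] S_closed[OF i(2)] T_closed[OF i(1)] this]
      show "S v f = T v f" using i(1) by (simp add: V.closed)
    qed
  qed
  finally show ?thesis .
qed


section \<open>Presented star-algebras\<close>

lemma star_hom_comp:
  assumes "\<phi> \<in> star_hom A B" "\<psi> \<in> star_hom B C"
  shows "\<psi> \<circ> \<phi> \<in> star_hom A C"
  using assms ring_hom_trans[of \<phi> A B \<psi> C] ring_hom_closed[of \<phi> A B]
  by (auto simp: star_hom_def)

lemma id_star_hom: "id \<in> star_hom A A"
  by (auto simp: star_hom_def ring_hom_def)

text \<open>
  Evaluation of star-polynomials takes an assignment of values in the carrier to all generators of
  the ambient type, so one given only on \<open>S\<close> has to be completed.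
\<close>

definition extend_by_zero :: "('a, 'm) star_algebra_scheme \<Rightarrow> 'g set \<Rightarrow> ('g \<Rightarrow> 'a) \<Rightarrow> 'g \<Rightarrow> 'a"
  where "extend_by_zero A S h g = (if g \<in> S then h g else \<zero>\<^bsub>A\<^esub>)"

lemma extend_by_zero_simp [simp]: "g \<in> S \<Longrightarrow> extend_by_zero A S h g = h g"
  by (simp add: extend_by_zero_def)

lemma (in star_algebra) extend_by_zero_closed:
  "(\<And>g. g \<in> S \<Longrightarrow> h g \<in> carrier A) \<Longrightarrow> extend_by_zero A S h g \<in> carrier A"
  by (simp add: extend_by_zero_def)

lemma gen_in_free: "g \<in> S \<Longrightarrow> gen g \<in> carrier (free_star_algebra S)"
  by (simp add: gen_def carrier_free word_in_def)

lemma sum_in_free: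
  "(\<And>k. k \<in> K \<Longrightarrow> f k \<in> carrier (free_star_algebra S)) \<Longrightarrow> sum f K \<in> carrier (free_star_algebra S)"
  by (induction K rule: infinite_finite_induct) (auto intro: carrier_free_intros)

lemma universal_gen_closed:
  assumes "R \<subseteq> carrier (free_star_algebra S)" "g \<in> S"
  shows "universal_gen S R g \<in> carrier (universal_star_algebra S R)"
proof -
  interpret F: star_algebra "free_star_algebra S" by (rule free_star_algebra)
  show ?thesis
    unfolding universal_gen_def universal_star_algebra_def
    using F.star_quotient_simps(7)[OF F.star_ideal_generated(1)[OF assms(1)] F.zero_closed F.zero_closed]
      gen_in_free[OF assms(2)] by auto
qed

text \<open>
  The identity is a star-homomorphism that extends the assignment of the classes of the generators,
  so the value of \<open>r\<close> at these classes is the class of \<open>r\<close> itself.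
\<close>

lemma universal_gen_satisfies:
  assumes R: "R \<subseteq> carrier (free_star_algebra S)" and r: "r \<in> R"
  defines "U \<equiv> universal_star_algebra S R"
  shows "star_algebra.eval U (extend_by_zero U S (universal_gen S R)) r = \<zero>\<^bsub>U\<^esub>"
proof -
  interpret F: star_algebra "free_star_algebra S" by (rule free_star_algebra)
  interpret U: star_algebra U unfolding U_def by (rule star_algebra_universal[OF R])
  define I where "I = star_ideal_generated (free_star_algebra S) R"
  have I: "star_ideal (free_star_algebra S) I" "r \<in> I"
    using F.star_ideal_generated[OF R] r by (auto simp: I_def)
  interpret I: ideal I "free_star_algebra S" using I by (simp add: star_ideal_def)
  have "id (I +>\<^bsub>free_star_algebra S\<^esub> r) = U.eval (extend_by_zero U S (universal_gen S R)) r"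
    unfolding I_def
  proof (rule star_hom_eq_eval[OF R U.star_algebra_axioms])
    show "id \<in> star_hom (universal_star_algebra S R) U" unfolding U_def by (rule id_star_hom)
    show "extend_by_zero U S (universal_gen S R) g \<in> carrier U" for g
      by (rule U.extend_by_zero_closed) (simp add: U_def universal_gen_closed[OF R])
  qed (use R r in auto)
  moreover have "I +>\<^bsub>free_star_algebra S\<^esub> r = I" using I(2) by (rule I.a_rcos_const)
  moreover have "\<zero>\<^bsub>U\<^esub> = I"
    unfolding U_def universal_star_algebra_def I_def[symmetric]
    by (rule F.star_quotient_simps(6)[OF I(1) F.zero_closed F.zero_closed])
  ultimately show ?thesis by simp
qed

lemma universal_star_hom_id:
  assumes R: "R \<subseteq> carrier (free_star_algebra S)"
    and \<theta>: "\<theta> \<in> star_hom (universal_star_algebra S R) (universal_star_algebra S R)"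
    and gens: "\<And>g. g \<in> S \<Longrightarrow> \<theta> (universal_gen S R g) = universal_gen S R g"
    and x: "x \<in> carrier (universal_star_algebra S R)"
  shows "\<theta> x = x"
proof -
  let ?U = "universal_star_algebra S R"
  interpret U: star_algebra ?U by (rule star_algebra_universal[OF R])
  have "\<theta> x = id x"
    proof (rule universal_property(2)[where \<psi> = \<theta> and \<chi> = id and x = x,
        OF R U.star_algebra_axioms _ universal_gen_satisfies[OF R]])
    show "extend_by_zero ?U S (universal_gen S R) g \<in> carrier ?U" for g
      using universal_gen_closed[OF R] by (rule U.extend_by_zero_closed)
  qed (use \<theta> gens x id_star_hom in auto)
  then show ?thesis by simp
qed

text \<open>
  The assignments \<open>h\<close> and \<open>k\<close> induce homomorphisms in opposite directions. The last two hypotheses say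
  that the composites fix the generators. They quantify over homomorphisms because \<open>h g\<close> and
  \<open>k g'\<close> need not be generators, so that the image of such a value cannot be written in terms of \<open>h\<close>
  and \<open>k\<close> alone.
\<close>

lemma universal_star_algebra_iso:
  assumes R: "R \<subseteq> carrier (free_star_algebra S)" and R': "R' \<subseteq> carrier (free_star_algebra S')"
  defines "U \<equiv> universal_star_algebra S R" and "U' \<equiv> universal_star_algebra S' R'"
  assumes h: "\<And>g. h g \<in> carrier U'" "\<And>r. r \<in> R \<Longrightarrow> star_algebra.eval U' h r = \<zero>\<^bsub>U'\<^esub>"
    and k: "\<And>g. k g \<in> carrier U" "\<And>r. r \<in> R' \<Longrightarrow> star_algebra.eval U k r = \<zero>\<^bsub>U\<^esub>"
    and kh: "\<And>\<psi> g. \<lbrakk>\<psi> \<in> star_hom U' U; \<And>g'. g' \<in> S' \<Longrightarrow> \<psi> (universal_gen S' R' g') = k g'; g \<in> S\<rbrakk>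
      \<Longrightarrow> \<psi> (h g) = universal_gen S R g"
    and hk: "\<And>\<phi> g'. \<lbrakk>\<phi> \<in> star_hom U U'; \<And>g. g \<in> S \<Longrightarrow> \<phi> (universal_gen S R g) = h g; g' \<in> S'\<rbrakk>
      \<Longrightarrow> \<phi> (k g') = universal_gen S' R' g'"
  shows "\<exists>\<phi>\<in>star_iso U U'. \<forall>g\<in>S. \<phi> (universal_gen S R g) = h g"
proof -
  interpret U: star_algebra U unfolding U_def by (rule star_algebra_universal[OF R])
  interpret U': star_algebra U' unfolding U'_def by (rule star_algebra_universal[OF R'])
  obtain \<phi> where \<phi>: "\<phi> \<in> star_hom U U'" "\<And>g. g \<in> S \<Longrightarrow> \<phi> (universal_gen S R g) = h g"
    using universal_property(1)[OF R U'.star_algebra_axioms h] unfolding U_def by blast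
  obtain \<psi> where \<psi>: "\<psi> \<in> star_hom U' U" "\<And>g. g \<in> S' \<Longrightarrow> \<psi> (universal_gen S' R' g) = k g"
    using universal_property(1)[OF R' U.star_algebra_axioms k] unfolding U'_def by blast
  have "\<psi> (\<phi> x) = x" if "x \<in> carrier U" for x
    using universal_star_hom_id[OF R, of "\<psi> \<circ> \<phi>" x] star_hom_comp[OF \<phi>(1) \<psi>(1)] kh[OF \<psi>] \<phi>(2) that
    by (simp add: U_def)
  moreover have "\<phi> (\<psi> x) = x" if "x \<in> carrier U'" for x
    using universal_star_hom_id[OF R', of "\<phi> \<circ> \<psi>" x] star_hom_comp[OF \<psi>(1) \<phi>(1)] hk[OF \<phi>] \<psi>(2) that
    by (simp add: U'_def)
  moreover have "\<phi> \<in> carrier U \<rightarrow> carrier U'" "\<psi> \<in> carrier U' \<rightarrow> carrier U"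
    using \<phi>(1) \<psi>(1) by (auto simp: star_hom_def ring_hom_def)
  ultimately have "bij_betw \<phi> (carrier U) (carrier U')"
    by (intro bij_betw_byWitness[where f' = \<psi>]) auto
  then show ?thesis using \<phi> by (auto simp: star_iso_def)
qed


section \<open>Values of the defining relations\<close>

lemma ball_image_set:
  "(\<forall>r\<in>{f x | x. Q1 x}. T r) \<longleftrightarrow> (\<forall>x. Q1 x \<longrightarrow> T (f x))"
  "(\<forall>r\<in>{g x y | x y. Q2 x y}. T r) \<longleftrightarrow> (\<forall>x y. Q2 x y \<longrightarrow> T (g x y))"
  "(\<forall>r\<in>{h x y z | x y z. Q3 x y z}. T r) \<longleftrightarrow> (\<forall>x y z. Q3 x y z \<longrightarrow> T (h x y z))"
  "(\<forall>r\<in>{k x y z u | x y z u. Q4 x y z u}. T r) \<longleftrightarrow> (\<forall>x y z u. Q4 x y z u \<longrightarrow> T (k x y z u))"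
  by blast+

context star_algebra
begin

context
  fixes h :: "'g \<Rightarrow> 'a"
  assumes h: "\<And>g. h g \<in> carrier A"
begin

lemma eval_diff_zero_iff: "eval h (p - q) = \<zero> \<longleftrightarrow> eval h p = eval h q"
proof -
  have "eval h p = eval h (p - q) \<oplus> eval h q"
    using eval_add[OF h, where p = "p - q" and q = q] by simp
  then show ?thesis
    using h by (simp add: add.r_cancel_one')
qed

lemma eval_sum:
  assumes "\<And>k. k \<in> K \<Longrightarrow> eval h (f k) = u k"
  shows "eval h (\<Sum>k\<in>K. f k) = (\<Oplus>k\<in>K. u k)"
proof -
  have "eval h (\<Sum>k\<in>K. f k) = (\<Oplus>k\<in>K. eval h (f k))"
    by (induction K rule: infinite_finite_induct) (auto simp: eval_add h)
  also have "\<dots> = (\<Oplus>k\<in>K. u k)"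
    using h by (intro add.finprod_cong') (auto simp flip: assms)
  finally show ?thesis .
qed

lemma magic_unitary_relations_iff:
  assumes fin: "finite I" "finite J" and q: "\<And>i j. \<lbrakk>i \<in> I; j \<in> J\<rbrakk> \<Longrightarrow> eval h (p i j) = q i j"
  shows "(\<forall>r\<in>magic_unitary_relations I J p. eval h r = \<zero>) \<longleftrightarrow> magic_unitary A I J q"
proof -
  have cl: "q i j \<in> carrier A" if "i \<in> I" "j \<in> J" for i j
    by (simp add: h flip: q[OF that])
  have row: "eval h (\<Sum>j\<in>J. p i j) = (\<Oplus>j\<in>J. q i j)" if "i \<in> I" for i
    using q that by (intro eval_sum) auto
  have col: "eval h (\<Sum>i\<in>I. p i j) = (\<Oplus>i\<in>I. q i j)" if "j \<in> J" for j
    using q that by (intro eval_sum) auto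
  have "(\<forall>r\<in>magic_unitary_relations I J p. eval h r = \<zero>) \<longleftrightarrow>
     (\<forall>i j. i \<in> I \<and> j \<in> J \<longrightarrow> eval h (poly_star (p i j) - p i j) = \<zero>) \<and>
     (\<forall>i j. i \<in> I \<and> j \<in> J \<longrightarrow> eval h (p i j * p i j - p i j) = \<zero>) \<and>
     (\<forall>i. i \<in> I \<longrightarrow> eval h ((\<Sum>j\<in>J. p i j) - 1) = \<zero>) \<and>
     (\<forall>j. j \<in> J \<longrightarrow> eval h ((\<Sum>i\<in>I. p i j) - 1) = \<zero>) \<and>
     (\<forall>i j j'. i \<in> I \<and> j \<in> J \<and> j' \<in> J \<and> j \<noteq> j' \<longrightarrow> eval h (p i j * p i j') = \<zero>) \<and>
     (\<forall>i i' j. i \<in> I \<and> i' \<in> I \<and> j \<in> J \<and> i \<noteq> i' \<longrightarrow> eval h (p i j * p i' j) = \<zero>)"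
    unfolding magic_unitary_relations_def ball_Un ball_image_set conj_assoc by (rule refl)
  also have "\<dots> \<longleftrightarrow>
     (\<forall>i j. i \<in> I \<and> j \<in> J \<longrightarrow> star A (q i j) = q i j) \<and>
     (\<forall>i j. i \<in> I \<and> j \<in> J \<longrightarrow> q i j \<otimes> q i j = q i j) \<and>
     (\<forall>i. i \<in> I \<longrightarrow> (\<Oplus>j\<in>J. q i j) = \<one>) \<and>
     (\<forall>j. j \<in> J \<longrightarrow> (\<Oplus>i\<in>I. q i j) = \<one>) \<and>
     (\<forall>i j j'. i \<in> I \<and> j \<in> J \<and> j' \<in> J \<and> j \<noteq> j' \<longrightarrow> q i j \<otimes> q i j' = \<zero>) \<and>
     (\<forall>i i' j. i \<in> I \<and> i' \<in> I \<and> j \<in> J \<and> i \<noteq> i' \<longrightarrow> q i j \<otimes> q i' j = \<zero>)"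
    by (simp add: eval_diff_zero_iff h eval_star eval_mult eval_one q row col cong: conj_cong)
  also have "\<dots> \<longleftrightarrow> magic_unitary A I J q"
    unfolding magic_unitary_def magic_unitary_axioms_def
    using fin cl star_algebra_axioms by (simp add: imp_conjL)
  finally show ?thesis .
qed

end

end

locale game_representation = star_algebra A for A :: "('a, 'm) star_algebra_scheme" (structure) +
  fixes X :: "'x set" and Y :: "'y set" and rule :: "'x \<Rightarrow> 'x \<Rightarrow> 'y \<Rightarrow> 'y \<Rightarrow> bool" and e :: "'x \<Rightarrow> 'y \<Rightarrow> 'a"
  assumes closed: "\<lbrakk>x \<in> X; a \<in> Y\<rbrakk> \<Longrightarrow> e x a \<in> carrier A"
    and self_adjoint: "\<lbrakk>x \<in> X; a \<in> Y\<rbrakk> \<Longrightarrow> star A (e x a) = e x a"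
    and idempotent: "\<lbrakk>x \<in> X; a \<in> Y\<rbrakk> \<Longrightarrow> e x a \<otimes> e x a = e x a"
    and answers_sum: "x \<in> X \<Longrightarrow> (\<Oplus>a\<in>Y. e x a) = \<one>"
    and losing_zero: "\<lbrakk>x \<in> X; y \<in> X; a \<in> Y; b \<in> Y; \<not> rule x y a b\<rbrakk> \<Longrightarrow> e x a \<otimes> e y b = \<zero>"

lemma (in star_algebra) game_relations_iff:
  assumes h: "\<And>g. h g \<in> carrier A" and e: "\<And>x a. \<lbrakk>x \<in> X; a \<in> Y\<rbrakk> \<Longrightarrow> h (x, a) = e x a"
  shows "(\<forall>r\<in>game_relations X Y rule. eval h r = \<zero>) \<longleftrightarrow> game_representation A X Y rule e"
proof -
  have g: "eval h (gen (x, a)) = e x a" if "x \<in> X" "a \<in> Y" for x a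
    using that by (simp add: eval_gen[OF h] e)
  have cl: "e x a \<in> carrier A" if "x \<in> X" "a \<in> Y" for x a
    using h[of "(x, a)"] e[OF that] by simp
  have sum: "eval h (\<Sum>a\<in>Y. gen (x, a)) = (\<Oplus>a\<in>Y. e x a)" if "x \<in> X" for x
    using g that by (intro eval_sum[OF h]) auto
  have "(\<forall>r\<in>game_relations X Y rule. eval h r = \<zero>) \<longleftrightarrow>
     (\<forall>x a. x \<in> X \<and> a \<in> Y \<longrightarrow> eval h (poly_star (gen (x, a)) - gen (x, a)) = \<zero>) \<and>
     (\<forall>x a. x \<in> X \<and> a \<in> Y \<longrightarrow> eval h (gen (x, a) * gen (x, a) - gen (x, a)) = \<zero>) \<and>
     (\<forall>x. x \<in> X \<longrightarrow> eval h ((\<Sum>a\<in>Y. gen (x, a)) - 1) = \<zero>) \<and>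
     (\<forall>x y a b. x \<in> X \<and> y \<in> X \<and> a \<in> Y \<and> b \<in> Y \<and> \<not> rule x y a b \<longrightarrow> eval h (gen (x, a) * gen (y, b)) = \<zero>)"
    unfolding game_relations_def ball_Un ball_image_set conj_assoc by (rule refl)
  also have "\<dots> \<longleftrightarrow>
     (\<forall>x a. x \<in> X \<and> a \<in> Y \<longrightarrow> star A (e x a) = e x a) \<and>
     (\<forall>x a. x \<in> X \<and> a \<in> Y \<longrightarrow> e x a \<otimes> e x a = e x a) \<and>
     (\<forall>x. x \<in> X \<longrightarrow> (\<Oplus>a\<in>Y. e x a) = \<one>) \<and>
     (\<forall>x y a b. x \<in> X \<and> y \<in> X \<and> a \<in> Y \<and> b \<in> Y \<and> \<not> rule x y a b \<longrightarrow> e x a \<otimes> e y b = \<zero>)"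
    by (simp add: eval_diff_zero_iff h eval_star eval_mult eval_one g sum cong: conj_cong)
  also have "\<dots> \<longleftrightarrow> game_representation A X Y rule e"
    unfolding game_representation_def game_representation_axioms_def
    using cl star_algebra_axioms by (simp add: imp_conjL)
  finally show ?thesis .
qed

text \<open>
  The products with the incidence matrices become sums over incident pairs, and these are traded for
  the local compatibility condition.
\<close>

lemma (in star_algebra) intertwiner_relations_iff:
  fixes \<Lambda>1 :: "('v1, 'e1) hypergraph" and \<Lambda>2 :: "('v2, 'e2) hypergraph"
  assumes full: "full_hypergraph \<Lambda>1" "full_hypergraph \<Lambda>2"
    and h: "\<And>g. h g \<in> carrier A"
    and P: "\<And>v w. \<lbrakk>v \<in> verts \<Lambda>1; w \<in> verts \<Lambda>2\<rbrakk> \<Longrightarrow> h (Inl (v, w)) = P v w"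
    and Q: "\<And>e f. \<lbrakk>e \<in> edges \<Lambda>1; f \<in> edges \<Lambda>2\<rbrakk> \<Longrightarrow> h (Inr (e, f)) = Q e f"
  shows "(\<forall>r\<in>intertwiner_relations \<Lambda>1 \<Lambda>2. eval h r = \<zero>) \<longleftrightarrow> compatible_unitaries A \<Lambda>1 \<Lambda>2 P Q"
proof -
  have fin: "finite (verts \<Lambda>1)" "finite (verts \<Lambda>2)" "finite (edges \<Lambda>1)" "finite (edges \<Lambda>2)"
    using full by (auto simp: full_hypergraph_def)
  let ?PV = "\<lambda>v w. gen (Inl (v, w)) :: ('v1 \<times> 'v2 + 'e1 \<times> 'e2) star_poly"
  let ?PE = "\<lambda>e f. gen (Inr (e, f)) :: ('v1 \<times> 'v2 + 'e1 \<times> 'e2) star_poly"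
  have magicP: "(\<forall>r\<in>magic_unitary_relations (verts \<Lambda>1) (verts \<Lambda>2) ?PV. eval h r = \<zero>)
      \<longleftrightarrow> magic_unitary A (verts \<Lambda>1) (verts \<Lambda>2) P"
    using fin by (intro magic_unitary_relations_iff[OF h]) (auto simp: eval_gen[OF h] P)
  have magicQ: "(\<forall>r\<in>magic_unitary_relations (edges \<Lambda>1) (edges \<Lambda>2) ?PE. eval h r = \<zero>)
      \<longleftrightarrow> magic_unitary A (edges \<Lambda>1) (edges \<Lambda>2) Q"
    using fin by (intro magic_unitary_relations_iff[OF h]) (auto simp: eval_gen[OF h] Q)
  have left: "eval h (matrix_product (edges \<Lambda>1) (incidence_matrix \<Lambda>1) ?PE v f)
      = (\<Oplus>e\<in>edges \<Lambda>1. if v \<in> ends \<Lambda>1 e then Q e f else \<zero>)" if "f \<in> edges \<Lambda>2" for v f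
    unfolding matrix_product_def using that
    by (intro eval_sum[OF h]) (auto simp: incidence_matrix_def eval_gen[OF h] Q eval_zero[OF h])
  have right: "eval h (matrix_product (verts \<Lambda>2) ?PV (incidence_matrix \<Lambda>2) v f)
      = (\<Oplus>w\<in>verts \<Lambda>2. if w \<in> ends \<Lambda>2 f then P v w else \<zero>)" if "v \<in> verts \<Lambda>1" for v f
    unfolding matrix_product_def using that
    by (intro eval_sum[OF h]) (auto simp: incidence_matrix_def eval_gen[OF h] P eval_zero[OF h])
  have "(\<forall>r\<in>intertwiner_relations \<Lambda>1 \<Lambda>2. eval h r = \<zero>) \<longleftrightarrow>
      magic_unitary A (verts \<Lambda>1) (verts \<Lambda>2) P \<and> magic_unitary A (edges \<Lambda>1) (edges \<Lambda>2) Q \<and>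
      (\<forall>v\<in>verts \<Lambda>1. \<forall>f\<in>edges \<Lambda>2. (\<Oplus>e\<in>edges \<Lambda>1. if v \<in> ends \<Lambda>1 e then Q e f else \<zero>)
        = (\<Oplus>w\<in>verts \<Lambda>2. if w \<in> ends \<Lambda>2 f then P v w else \<zero>))"
    unfolding intertwiner_relations_def Let_def ball_Un magicP magicQ ball_image_set
    by (auto simp: eval_diff_zero_iff[OF h] left right)
  also have "\<dots> \<longleftrightarrow> compatible_unitaries A \<Lambda>1 \<Lambda>2 P Q"
    using full intertwining_iff_compatible[of A "verts \<Lambda>1" "verts \<Lambda>2" P "edges \<Lambda>1" "edges \<Lambda>2" Q "ends \<Lambda>1" "ends \<Lambda>2"]
    unfolding compatible_unitaries_def compatible_unitaries_axioms_def by blast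
  finally show ?thesis .
qed


section \<open>Strategies for the hypergraph isomorphism game\<close>

lemma relation_refl [simp]:
  "vertex_relation \<Lambda> v v = Same" "edge_relation \<Lambda> e e = Same"
  by (auto simp: vertex_relation_def edge_relation_def)

lemma relation_eq_Same_iff [simp]:
  "vertex_relation \<Lambda> v v' = Same \<longleftrightarrow> v = v'" "Same = vertex_relation \<Lambda> v v' \<longleftrightarrow> v = v'"
  "edge_relation \<Lambda> e e' = Same \<longleftrightarrow> e = e'" "Same = edge_relation \<Lambda> e e' \<longleftrightarrow> e = e'"
  by (auto simp: vertex_relation_def edge_relation_def)

lemma finite_items:
  "\<lbrakk>full_hypergraph \<Lambda>1; full_hypergraph \<Lambda>2\<rbrakk> \<Longrightarrow> finite (hypiso_items \<Lambda>1 \<Lambda>2)"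
  by (simp add: hypiso_items_def full_hypergraph_def)

lemma mem_items [simp]:
  "V1 v \<in> hypiso_items \<Lambda>1 \<Lambda>2 \<longleftrightarrow> v \<in> verts \<Lambda>1" "V2 w \<in> hypiso_items \<Lambda>1 \<Lambda>2 \<longleftrightarrow> w \<in> verts \<Lambda>2"
  "E1 e \<in> hypiso_items \<Lambda>1 \<Lambda>2 \<longleftrightarrow> e \<in> edges \<Lambda>1" "E2 f \<in> hypiso_items \<Lambda>1 \<Lambda>2 \<longleftrightarrow> f \<in> edges \<Lambda>2"
  by (auto simp: hypiso_items_def)

locale hypiso_representation =
  game_representation A "hypiso_items \<Lambda>1 \<Lambda>2" "hypiso_items \<Lambda>1 \<Lambda>2" "hypiso_rule \<Lambda>1 \<Lambda>2" e
  for A :: "('a, 'm) star_algebra_scheme" (structure)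
    and \<Lambda>1 :: "('v1, 'e1) hypergraph" and \<Lambda>2 :: "('v2, 'e2) hypergraph" and e +
  assumes full1: "full_hypergraph \<Lambda>1" and full2: "full_hypergraph \<Lambda>2"
begin

text \<open>An answer of the wrong kind loses against itself, so \<open>e x a\<close> squares to zero.\<close>

lemma wrong_kind_zero:
  assumes "x \<in> hypiso_items \<Lambda>1 \<Lambda>2" "a \<in> hypiso_items \<Lambda>1 \<Lambda>2" "\<not> answer_kind x a"
  shows "e x a = \<zero>"
  using idempotent[OF assms(1,2)] losing_zero[OF assms(1,1,2,2)] assms(3)
  by (simp add: hypiso_rule_def)

lemma right_kind_sum:
  assumes "x \<in> hypiso_items \<Lambda>1 \<Lambda>2" "inj_on c K" "c ` K \<subseteq> hypiso_items \<Lambda>1 \<Lambda>2"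
    and "\<And>a. \<lbrakk>a \<in> hypiso_items \<Lambda>1 \<Lambda>2; answer_kind x a\<rbrakk> \<Longrightarrow> a \<in> c ` K"
  shows "(\<Oplus>k\<in>K. e x (c k)) = \<one>"
proof -
  have "(\<Oplus>a\<in>hypiso_items \<Lambda>1 \<Lambda>2. e x a) = (\<Oplus>k\<in>K. e x (c k))"
    using assms closed finite_items[OF full1 full2]
    by (intro finsum_over_image) (auto intro: wrong_kind_zero)
  then show ?thesis using answers_sum[OF assms(1)] by simp
qed

lemma vertex_sums:
  "v \<in> verts \<Lambda>1 \<Longrightarrow> (\<Oplus>w\<in>verts \<Lambda>2. e (V1 v) (V2 w)) = \<one>"
  "w \<in> verts \<Lambda>2 \<Longrightarrow> (\<Oplus>v\<in>verts \<Lambda>1. e (V2 w) (V1 v)) = \<one>"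
  by (intro right_kind_sum; auto simp: inj_on_def)+

lemma edge_sums:
  "d \<in> edges \<Lambda>1 \<Longrightarrow> (\<Oplus>f\<in>edges \<Lambda>2. e (E1 d) (E2 f)) = \<one>"
  "f \<in> edges \<Lambda>2 \<Longrightarrow> (\<Oplus>d\<in>edges \<Lambda>1. e (E2 f) (E1 d)) = \<one>"
  by (intro right_kind_sum; auto simp: inj_on_def)+

lemma vertex_zero:
  assumes "v \<in> verts \<Lambda>1" "v' \<in> verts \<Lambda>1" "w \<in> verts \<Lambda>2" "w' \<in> verts \<Lambda>2"
    and "vertex_relation \<Lambda>1 v v' \<noteq> vertex_relation \<Lambda>2 w w'"
  shows "e (V1 v) (V2 w) \<otimes> e (V1 v') (V2 w') = \<zero>" "e (V1 v) (V2 w) \<otimes> e (V2 w') (V1 v') = \<zero>"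
  using assms by (auto intro!: losing_zero simp: hypiso_rule_def doubleton_eq_iff)

lemma edge_zero:
  assumes "d \<in> edges \<Lambda>1" "d' \<in> edges \<Lambda>1" "f \<in> edges \<Lambda>2" "f' \<in> edges \<Lambda>2"
    and "edge_relation \<Lambda>1 d d' \<noteq> edge_relation \<Lambda>2 f f'"
  shows "e (E1 d) (E2 f) \<otimes> e (E1 d') (E2 f') = \<zero>" "e (E1 d) (E2 f) \<otimes> e (E2 f') (E1 d') = \<zero>"
  using assms by (auto intro!: losing_zero simp: hypiso_rule_def doubleton_eq_iff)

text \<open>
  If Alice's pair \<open>(v, w)\<close> and Bob's pair \<open>(v', w')\<close> agree in one coordinate but not in the other, they
  lose. These are the vanishing products that \<open>opposite_partitions_eq\<close> requires.
\<close>

lemma opposite_vertex: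
  assumes "v \<in> verts \<Lambda>1" "w \<in> verts \<Lambda>2"
  shows "e (V2 w) (V1 v) = e (V1 v) (V2 w)"
  using assms full1 full2
  by (intro opposite_partitions_eq[where p = "\<lambda>v w. e (V1 v) (V2 w)" and q = "\<lambda>w v. e (V2 w) (V1 v)"
        and I = "verts \<Lambda>1" and J = "verts \<Lambda>2"] vertex_sums vertex_zero(2))
    (auto simp: full_hypergraph_def closed)

lemma opposite_edge:
  assumes "d \<in> edges \<Lambda>1" "f \<in> edges \<Lambda>2"
  shows "e (E2 f) (E1 d) = e (E1 d) (E2 f)"
  using assms full1 full2
  by (intro opposite_partitions_eq[where p = "\<lambda>d f. e (E1 d) (E2 f)" and q = "\<lambda>f d. e (E2 f) (E1 d)"
        and I = "edges \<Lambda>1" and J = "edges \<Lambda>2"] edge_sums edge_zero(2))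
    (auto simp: full_hypergraph_def closed)

lemma vertex_magic: "magic_unitary A (verts \<Lambda>1) (verts \<Lambda>2) (\<lambda>v w. e (V1 v) (V2 w))"
proof
  show "(\<Oplus>v\<in>verts \<Lambda>1. e (V1 v) (V2 w)) = \<one>" if "w \<in> verts \<Lambda>2" for w
  proof -
    have "(\<Oplus>v\<in>verts \<Lambda>1. e (V1 v) (V2 w)) = (\<Oplus>v\<in>verts \<Lambda>1. e (V2 w) (V1 v))"
      using that by (intro add.finprod_cong') (auto simp: opposite_vertex closed)
    then show ?thesis using that by (simp add: vertex_sums)
  qed
qed (use full1 full2 in
    \<open>auto intro: closed self_adjoint idempotent vertex_sums vertex_zero(1) simp: full_hypergraph_def\<close>)

lemma edge_magic: "magic_unitary A (edges \<Lambda>1) (edges \<Lambda>2) (\<lambda>d f. e (E1 d) (E2 f))"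
proof
  show "(\<Oplus>d\<in>edges \<Lambda>1. e (E1 d) (E2 f)) = \<one>" if "f \<in> edges \<Lambda>2" for f
  proof -
    have "(\<Oplus>d\<in>edges \<Lambda>1. e (E1 d) (E2 f)) = (\<Oplus>d\<in>edges \<Lambda>1. e (E2 f) (E1 d))"
      using that by (intro add.finprod_cong') (auto simp: opposite_edge closed)
    then show ?thesis using that by (simp add: edge_sums)
  qed
qed (use full1 full2 in
    \<open>auto intro: closed self_adjoint idempotent edge_sums edge_zero(1) simp: full_hypergraph_def\<close>)

lemma compatible_unitaries:
  "compatible_unitaries A \<Lambda>1 \<Lambda>2 (\<lambda>v w. e (V1 v) (V2 w)) (\<lambda>d f. e (E1 d) (E2 f))"
  using vertex_magic edge_magic full1 full2
  by (auto intro!: compatible_unitaries.intro compatible_unitaries_axioms.intro losing_zero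
      simp: hypiso_rule_def)

end

context star_algebra
begin

fun answer_projection ::
  "('v1 \<Rightarrow> 'v2 \<Rightarrow> 'a) \<Rightarrow> ('e1 \<Rightarrow> 'e2 \<Rightarrow> 'a) \<Rightarrow>
    ('v1, 'v2, 'e1, 'e2) item \<Rightarrow> ('v1, 'v2, 'e1, 'e2) item \<Rightarrow> 'a" where
  "answer_projection P Q (V1 v) (V2 w) = P v w"
| "answer_projection P Q (V2 w) (V1 v) = P v w"
| "answer_projection P Q (E1 e) (E2 f) = Q e f"
| "answer_projection P Q (E2 f) (E1 e) = Q e f"
| "answer_projection P Q _ _ = \<zero>"

lemma answer_projection_wrong_kind: "\<not> answer_kind x a \<Longrightarrow> answer_projection P Q x a = \<zero>"
  by (cases x; cases a) auto

end

lemma right_kind_cases [consumes 1, case_names V12 V21 E12 E21]: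
  assumes "answer_kind x a"
  obtains v w where "x = V1 v" "a = V2 w" | v w where "x = V2 w" "a = V1 v"
    | e f where "x = E1 e" "a = E2 f" | e f where "x = E2 f" "a = E1 e"
  using assms by (cases x) auto

context compatible_unitaries
begin

abbreviation "items \<equiv> hypiso_items \<Lambda>1 \<Lambda>2"
abbreviation "proj \<equiv> V.answer_projection P Q"

lemma answer_projection_closed: "\<lbrakk>x \<in> items; a \<in> items\<rbrakk> \<Longrightarrow> proj x a \<in> carrier A"
  by (cases x; cases a) (auto simp: V.closed E.closed)

lemma answer_projection_sum:
  assumes "x \<in> items"
  shows "(\<Oplus>a\<in>items. proj x a) = \<one>"
proof -
  have collapse: "(\<Oplus>a\<in>items. proj x a) = (\<Oplus>k\<in>K. proj x (c k))"
    if "inj_on c K" "c ` K \<subseteq> items" "\<And>a. \<lbrakk>a \<in> items; answer_kind x a\<rbrakk> \<Longrightarrow> a \<in> c ` K"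
    for c :: "'k \<Rightarrow> _" and K
    using that assms finite_items[OF full1 full2]
    by (intro V.finsum_over_image) (auto simp: answer_projection_closed intro: V.answer_projection_wrong_kind)
  show ?thesis
  proof (cases x)
    case (V1 v)
    then show ?thesis
      using assms by (subst collapse[of V2 "verts \<Lambda>2"]) (auto simp: inj_on_def V.row_sum)
  next
    case (V2 w)
    then show ?thesis
      using assms by (subst collapse[of V1 "verts \<Lambda>1"]) (auto simp: inj_on_def V.col_sum)
  next
    case (E1 e)
    then show ?thesis
      using assms by (subst collapse[of E2 "edges \<Lambda>2"]) (auto simp: inj_on_def E.row_sum)
  next
    case (E2 f)
    then show ?thesis
      using assms by (subst collapse[of E1 "edges \<Lambda>1"]) (auto simp: inj_on_def E.col_sum)
  qed
qed

text \<open>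
  If both answers are of the right kind, a lost round concerns two vertices, two hyperedges, or a
  vertex asked of Alice and a hyperedge of the same hypergraph asked of Bob.
\<close>

lemma answer_projection_losing:
  assumes "x \<in> items" "y \<in> items" "a \<in> items" "b \<in> items" and lost: "\<not> hypiso_rule \<Lambda>1 \<Lambda>2 x y a b"
  shows "proj x a \<otimes> proj y b = \<zero>"
proof (cases "answer_kind x a \<and> answer_kind y b")
  case False
  then show ?thesis
    using answer_projection_closed assms by (auto simp: V.answer_projection_wrong_kind)
next
  case True
  then have "answer_kind x a" "answer_kind y b" by auto
  then show ?thesis
    by (elim right_kind_cases; insert assms;
        auto simp: hypiso_rule_def doubleton_eq_iff
          intro: vertex_relation_zero edge_relation_zero compatible)
qed

lemma hypiso_representation: "hypiso_representation A \<Lambda>1 \<Lambda>2 proj"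
proof
  fix x a :: "('v1, 'v2, 'e1, 'e2) item"
  assume "x \<in> items" "a \<in> items"
  then show "star A (proj x a) = proj x a" "proj x a \<otimes> proj x a = proj x a"
    by (cases x; cases a; auto simp: V.self_adjoint E.self_adjoint V.idempotent E.idempotent V.star_zero)+
qed (auto intro: answer_projection_closed answer_projection_sum answer_projection_losing full1 full2)

end


section \<open>The isomorphism\<close>

lemma game_relations_in_free:
  "game_relations X Y rule \<subseteq> carrier (free_star_algebra (X \<times> Y))"
  by (auto simp: game_relations_def intro!: carrier_free_intros sum_in_free gen_in_free)

lemma magic_unitary_relations_in_free:
  assumes "\<And>i j. \<lbrakk>i \<in> I; j \<in> J\<rbrakk> \<Longrightarrow> p i j \<in> carrier (free_star_algebra S)"
  shows "magic_unitary_relations I J p \<subseteq> carrier (free_star_algebra S)"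
  using assms by (auto simp: magic_unitary_relations_def intro!: carrier_free_intros sum_in_free)

lemma intertwiner_relations_in_free:
  "intertwiner_relations \<Lambda>1 \<Lambda>2 \<subseteq> carrier (free_star_algebra (intertwiner_indices \<Lambda>1 \<Lambda>2))"
  unfolding intertwiner_relations_def Let_def
  by (intro Un_least magic_unitary_relations_in_free)
    (auto simp: intertwiner_indices_def matrix_product_def incidence_matrix_def
      intro!: carrier_free_intros sum_in_free gen_in_free)

lemma star_hom_zero:
  assumes "\<phi> \<in> star_hom A B" "star_algebra A" "star_algebra B"
  shows "\<phi> \<zero>\<^bsub>A\<^esub> = \<zero>\<^bsub>B\<^esub>"
  using assms by (intro ring_hom_zero) (auto simp: star_hom_def star_algebra_def)

text \<open>The two universal algebras carry the tautological representations of their own relations.\<close>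

lemma hypiso_gens_representation:
  assumes "full_hypergraph \<Lambda>1" "full_hypergraph \<Lambda>2"
  shows "hypiso_representation (hypiso_algebra \<Lambda>1 \<Lambda>2) \<Lambda>1 \<Lambda>2 (hypiso_gen \<Lambda>1 \<Lambda>2)"
proof -
  define X where "X = hypiso_items \<Lambda>1 \<Lambda>2"
  define R where "R = game_relations X X (hypiso_rule \<Lambda>1 \<Lambda>2)"
  define U where "U = universal_star_algebra (X \<times> X) R"
  have R: "R \<subseteq> carrier (free_star_algebra (X \<times> X))"
    unfolding R_def by (rule game_relations_in_free)
  interpret U: star_algebra U unfolding U_def by (rule star_algebra_universal[OF R])
  let ?h = "extend_by_zero U (X \<times> X) (universal_gen (X \<times> X) R)"
  have "?h g \<in> carrier U" for g
    by (rule U.extend_by_zero_closed) (simp add: U_def universal_gen_closed[OF R])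
  moreover have "?h (x, a) = hypiso_gen \<Lambda>1 \<Lambda>2 x a" if "x \<in> X" "a \<in> X" for x a
    using that by (simp add: hypiso_gen_def game_gen_def X_def R_def)
  moreover have "\<forall>r\<in>R. U.eval ?h r = \<zero>\<^bsub>U\<^esub>"
    unfolding U_def by (intro ballI universal_gen_satisfies[OF R])
  ultimately have "game_representation U X X (hypiso_rule \<Lambda>1 \<Lambda>2) (hypiso_gen \<Lambda>1 \<Lambda>2)"
    using U.game_relations_iff[of ?h X X "hypiso_gen \<Lambda>1 \<Lambda>2" "hypiso_rule \<Lambda>1 \<Lambda>2"]
    by (simp flip: R_def)
  moreover have "U = hypiso_algebra \<Lambda>1 \<Lambda>2"
    by (simp add: U_def hypiso_algebra_def game_algebra_def R_def X_def)
  ultimately show ?thesis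
    using assms by (simp add: hypiso_representation_def hypiso_representation_axioms_def X_def)
qed

lemma intertwiner_gens_compatible:
  assumes "full_hypergraph \<Lambda>1" "full_hypergraph \<Lambda>2"
  shows "compatible_unitaries (intertwiner_algebra \<Lambda>1 \<Lambda>2) \<Lambda>1 \<Lambda>2 (vertex_gen \<Lambda>1 \<Lambda>2) (edge_gen \<Lambda>1 \<Lambda>2)"
proof -
  define S where "S = intertwiner_indices \<Lambda>1 \<Lambda>2"
  define R where "R = intertwiner_relations \<Lambda>1 \<Lambda>2"
  define U where "U = universal_star_algebra S R"
  have R: "R \<subseteq> carrier (free_star_algebra S)"
    unfolding R_def S_def by (rule intertwiner_relations_in_free)
  interpret U: star_algebra U unfolding U_def by (rule star_algebra_universal[OF R])
  let ?h = "extend_by_zero U S (universal_gen S R)"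
  have "?h g \<in> carrier U" for g
    by (rule U.extend_by_zero_closed) (simp add: U_def universal_gen_closed[OF R])
  moreover have "?h (Inl (v, w)) = vertex_gen \<Lambda>1 \<Lambda>2 v w" if "v \<in> verts \<Lambda>1" "w \<in> verts \<Lambda>2" for v w
    using that by (simp add: vertex_gen_def S_def R_def intertwiner_indices_def)
  moreover have "?h (Inr (e, f)) = edge_gen \<Lambda>1 \<Lambda>2 e f" if "e \<in> edges \<Lambda>1" "f \<in> edges \<Lambda>2" for e f
    using that by (simp add: edge_gen_def S_def R_def intertwiner_indices_def)
  moreover have "\<forall>r\<in>R. U.eval ?h r = \<zero>\<^bsub>U\<^esub>"
    unfolding U_def by (intro ballI universal_gen_satisfies[OF R])
  ultimately have "compatible_unitaries U \<Lambda>1 \<Lambda>2 (vertex_gen \<Lambda>1 \<Lambda>2) (edge_gen \<Lambda>1 \<Lambda>2)"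
    using U.intertwiner_relations_iff[OF assms, of ?h "vertex_gen \<Lambda>1 \<Lambda>2" "edge_gen \<Lambda>1 \<Lambda>2"]
    by (simp flip: R_def)
  moreover have "U = intertwiner_algebra \<Lambda>1 \<Lambda>2"
    by (simp add: U_def intertwiner_algebra_def R_def S_def)
  ultimately show ?thesis by simp
qed

theorem proposition3p4:
  fixes \<Lambda>1 :: "('v1, 'e1) hypergraph"
    and \<Lambda>2 :: "('v2, 'e2) hypergraph"
  assumes "full_hypergraph \<Lambda>1" and "full_hypergraph \<Lambda>2"
  shows "\<exists>\<phi> \<in> star_iso (intertwiner_algebra \<Lambda>1 \<Lambda>2) (hypiso_algebra \<Lambda>1 \<Lambda>2).
    (\<forall>v\<in>verts \<Lambda>1. \<forall>w\<in>verts \<Lambda>2.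
      \<phi> (vertex_gen \<Lambda>1 \<Lambda>2 v w) = hypiso_gen \<Lambda>1 \<Lambda>2 (V1 v) (V2 w)) \<and>
    (\<forall>e\<in>edges \<Lambda>1. \<forall>f\<in>edges \<Lambda>2.
      \<phi> (edge_gen \<Lambda>1 \<Lambda>2 e f) = hypiso_gen \<Lambda>1 \<Lambda>2 (E1 e) (E2 f))"
proof -
  define S where "S = intertwiner_indices \<Lambda>1 \<Lambda>2"
  define R where "R = intertwiner_relations \<Lambda>1 \<Lambda>2"
  define X where "X = hypiso_items \<Lambda>1 \<Lambda>2"
  define R' where "R' = game_relations X X (hypiso_rule \<Lambda>1 \<Lambda>2)"
  define U where "U = intertwiner_algebra \<Lambda>1 \<Lambda>2"
  define U' where "U' = hypiso_algebra \<Lambda>1 \<Lambda>2"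
  have U: "U = universal_star_algebra S R"
    by (simp add: U_def intertwiner_algebra_def R_def S_def)
  have U': "U' = universal_star_algebra (X \<times> X) R'"
    by (simp add: U'_def hypiso_algebra_def game_algebra_def R'_def X_def)
  have gens: "vertex_gen \<Lambda>1 \<Lambda>2 v w = universal_gen S R (Inl (v, w))"
    "edge_gen \<Lambda>1 \<Lambda>2 e f = universal_gen S R (Inr (e, f))" for v w e f
    by (simp_all add: vertex_gen_def edge_gen_def S_def R_def)
  have game_gens: "hypiso_gen \<Lambda>1 \<Lambda>2 x a = universal_gen (X \<times> X) R' (x, a)" for x a
    by (simp add: hypiso_gen_def game_gen_def X_def R'_def)
  interpret G: hypiso_representation U' \<Lambda>1 \<Lambda>2 "hypiso_gen \<Lambda>1 \<Lambda>2"
    unfolding U'_def by (rule hypiso_gens_representation[OF assms])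
  interpret H: compatible_unitaries U \<Lambda>1 \<Lambda>2 "vertex_gen \<Lambda>1 \<Lambda>2" "edge_gen \<Lambda>1 \<Lambda>2"
    unfolding U_def by (rule intertwiner_gens_compatible[OF assms])
  define h where "h = extend_by_zero U' S (case_sum
    (\<lambda>(v, w). hypiso_gen \<Lambda>1 \<Lambda>2 (V1 v) (V2 w)) (\<lambda>(e, f). hypiso_gen \<Lambda>1 \<Lambda>2 (E1 e) (E2 f)))"
  define k where "k = extend_by_zero U (X \<times> X) (\<lambda>(x, a). H.proj x a)"
  have h_simps: "v \<in> verts \<Lambda>1 \<Longrightarrow> w \<in> verts \<Lambda>2 \<Longrightarrow> h (Inl (v, w)) = hypiso_gen \<Lambda>1 \<Lambda>2 (V1 v) (V2 w)"
    "e \<in> edges \<Lambda>1 \<Longrightarrow> f \<in> edges \<Lambda>2 \<Longrightarrow> h (Inr (e, f)) = hypiso_gen \<Lambda>1 \<Lambda>2 (E1 e) (E2 f)" for v w e f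
    by (simp_all add: h_def S_def intertwiner_indices_def)
  have k_simp: "k (x, a) = H.proj x a" if "x \<in> X" "a \<in> X" for x a
    using that by (simp add: k_def)
  have h_closed: "h g \<in> carrier U'" for g
    unfolding h_def
    by (rule G.extend_by_zero_closed) (auto simp: S_def intertwiner_indices_def G.closed)
  have k_closed: "k g \<in> carrier U" for g
    unfolding k_def
    by (rule H.V.extend_by_zero_closed) (auto simp: X_def H.answer_projection_closed)
  have h_rel: "\<forall>r\<in>R. G.eval h r = \<zero>\<^bsub>U'\<^esub>"
    using G.intertwiner_relations_iff[OF assms h_closed h_simps] G.compatible_unitaries
    by (simp add: R_def)
  have k_rel: "\<forall>r\<in>R'. H.V.eval k r = \<zero>\<^bsub>U\<^esub>"
    using H.V.game_relations_iff[where h = k and e = H.proj and X = X and Y = X, OF k_closed k_simp] H.hypiso_representation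
    by (simp add: R'_def X_def hypiso_representation_def)
  have "\<exists>\<phi>\<in>star_iso U U'. \<forall>g\<in>S. \<phi> (universal_gen S R g) = h g"
    unfolding U U'
  proof (rule universal_star_algebra_iso; (unfold U[symmetric] U'[symmetric])?)
    show "R \<subseteq> carrier (free_star_algebra S)"
      unfolding R_def S_def by (rule intertwiner_relations_in_free)
    show "R' \<subseteq> carrier (free_star_algebra (X \<times> X))"
      unfolding R'_def by (rule game_relations_in_free)
    show "h g \<in> carrier U'" for g by (rule h_closed)
    show "k g \<in> carrier U" for g by (rule k_closed)
    show "G.eval h r = \<zero>\<^bsub>U'\<^esub>" if "r \<in> R" for r using h_rel that by blast
    show "H.V.eval k r = \<zero>\<^bsub>U\<^esub>" if "r \<in> R'" for r using k_rel that by blast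
    show "\<psi> (h g) = universal_gen S R g"
      if \<psi>: "\<And>g'. g' \<in> X \<times> X \<Longrightarrow> \<psi> (universal_gen (X \<times> X) R' g') = k g'" and g: "g \<in> S" for \<psi> g
      using g \<psi> by (auto simp: S_def intertwiner_indices_def h_simps game_gens k_simp X_def gens)
    show "\<phi> (k g') = universal_gen (X \<times> X) R' g'"
      if \<phi>: "\<phi> \<in> star_hom U U'" "\<And>g. g \<in> S \<Longrightarrow> \<phi> (universal_gen S R g) = h g" and g': "g' \<in> X \<times> X" for \<phi> g'
    proof -
      obtain x a where xa: "g' = (x, a)" "x \<in> X" "a \<in> X" using g' by auto
      have "\<phi> (H.proj x a) = hypiso_gen \<Lambda>1 \<Lambda>2 x a"
      proof (cases "answer_kind x a")
        case False
        \<comment> \<open>Here \<open>k\<close> takes the value zero, so the generator of the game algebra has to vanish as well.\<close>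
        then show ?thesis
          using star_hom_zero[OF \<phi>(1) H.V.star_algebra_axioms G.star_algebra_axioms] xa
          by (simp add: H.V.answer_projection_wrong_kind G.wrong_kind_zero X_def)
      next
        case True
        then show ?thesis
          using xa \<phi>(2)
          by (cases rule: right_kind_cases)
            (auto simp: X_def S_def intertwiner_indices_def gens h_simps G.opposite_vertex G.opposite_edge)
      qed
      then show ?thesis using xa by (simp add: k_simp game_gens)
    qed
  qed
  then obtain \<phi> where \<phi>: "\<phi> \<in> star_iso U U'" "\<And>g. g \<in> S \<Longrightarrow> \<phi> (universal_gen S R g) = h g" by blast
  show ?thesis
  proof (intro bexI[of _ \<phi>] conjI ballI)
    show "\<phi> \<in> star_iso (intertwiner_algebra \<Lambda>1 \<Lambda>2) (hypiso_algebra \<Lambda>1 \<Lambda>2)"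
      using \<phi>(1) by (simp add: U_def U'_def)
    show "\<phi> (vertex_gen \<Lambda>1 \<Lambda>2 v w) = hypiso_gen \<Lambda>1 \<Lambda>2 (V1 v) (V2 w)"
      if "v \<in> verts \<Lambda>1" "w \<in> verts \<Lambda>2" for v w
      using that \<phi>(2)[of "Inl (v, w)"] by (simp add: gens h_simps S_def intertwiner_indices_def)
    show "\<phi> (edge_gen \<Lambda>1 \<Lambda>2 e f) = hypiso_gen \<Lambda>1 \<Lambda>2 (E1 e) (E2 f)"
      if "e \<in> edges \<Lambda>1" "f \<in> edges \<Lambda>2" for e f
      using that \<phi>(2)[of "Inr (e, f)"] by (simp add: gens h_simps S_def intertwiner_indices_def)
  qed
qed

end
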